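(* For every $\kappa\in\mathbb Z$, the set $\overline N_{0,\kappa}$ is an open compact subgroup of $\overline N(F)$. For $\kappa_1\le\kappa_2$, one has $\overline N_{0,\kappa_1}\subset\overline N_{0,\kappa_2}$, and $$\bigcup_{\kappa\ge0}\overline N_{0,\kappa}=\overline N(F).$$ Moreover $\overline N_{0,\kappa}$ is normalized by $U_0$. Finally, for the cocharacter $\alpha^\vee:=\gamma_0^\vee:F^\times\to Z_M$, $$\alpha^\vee(t)\,\overline N_{0,\kappa}\,\alpha^\vee(t)^{-1}=\overline N_{0,\kappa+v_F(t)}.$$ In particular $\alpha^\vee(t)\overline N_{0,\kappa}\alpha^\vee(t)^{-1}$ depends only on $v_F(t)$, equivalently only on $|t|$.
   Context: $F$ is a $p$-adic field with uniformizer $\varpi$ and additive valuation $v_F$ normalized by $v_F(\varpi)=1$, $v_F(0)=+\infty$; $\mathfrak p^r=\{a\in F:v_F(a)\ge r\}$ for $r\in\mathbb Z$. $G$ is the split simply connected group of type $E_6$ over $F$ with a fixed $F$-splitting $(B=AU,A,\{x_\alpha\})$, extended to a Chevalley system of root subgroups $x_\beta:\mathbb G_a\to U_\beta$ (integral structure constants); simple roots are in Bourbaki's labelling (chain $\alpha_1,\alpha_3,\alpha_4,\alpha_5,\alpha_6$, with $\alpha_2$ attached to $\alpha_4$). $P=MN$ is the standard maximal parabolic subgroup obtained by deleting $\alpha_2$, $\overline N$ the opposite of $N$, $U_M=U\cap M$, $Z_M$ the center of $M$, $\Phi_N$ the set of roots in $N$, $\Phi_N^-=-\Phi_N$, $\Phi_M^+$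 the positive roots of $M$. $\gamma_0=\alpha_1+2\alpha_2+2\alpha_3+3\alpha_4+2\alpha_5+\alpha_6$ is the highest root and $\Phi_N^{-,\circ}=\Phi_N^-\setminus\{-\gamma_0\}$. Put $U_{\beta,r}=x_\beta(\mathfrak p^r)$ and $x=2\rho^\vee\in X_*(A)$ (the sum of the positive coroots), with $\beta(x)=\langle\beta,x\rangle$. For $\kappa\in\mathbb Z$ let $$\overline r_{x,\kappa}(\eta)=\begin{cases}-\kappa-\eta(x),&\eta\in\Phi_N^{-,\circ},\\-2\kappa-\eta(x),&\eta=-\gamma_0.\end{cases}$$ Fix a total ordering of $\Phi_N^-$ in which $-\gamma_0$ is last and define, with ordered products, $$\overline N_{0,\kappa}=\prod_{\eta\in\Phi_N^-}U_{\eta,\overline r_{x,\kappa}(\eta)}\subset\overline N(F),\qquad U_0=\prod_{\alpha\in\Phi_M^+}U_{\alpha,-\alpha(x)}\subset U_M(F).$$ ($U_0$ is the group $U_M\cap G_{x,0}$ in Moy-Prasad notation.) *)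

theory Defs
  imports "HOL-Analysis.Analysis" "HOL-Algebra.Generated_Groups" "HOL-Algebra.Coset"
begin

section \<open>p-adic fields\<close>

text \<open>The valuation is an integer-valued function whose value at \<open>0\<close> is irrelevant;
  the convention that \<open>0\<close> has valuation \<open>+\<infinity>\<close> is built into the fractional ideals.\<close>

definition frac_ideal :: "('f::field \<Rightarrow> int) \<Rightarrow> int \<Rightarrow> 'f set" where
  "frac_ideal v r = {a. a = 0 \<or> r \<le> v a}"

definition residue_field :: "('f::field \<Rightarrow> int) \<Rightarrow> 'f set set" where
  "residue_field v = (\<lambda>a. (+) a ` frac_ideal v 1) ` frac_ideal v 0"

locale p_adic_field =
  fixes v :: "'f::field_char_0 \<Rightarrow> int"
  assumes v_mult: "a \<noteq> 0 \<Longrightarrow> b \<noteq> 0 \<Longrightarrow> v (a * b) = v a + v b"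
    and v_add: "a \<noteq> 0 \<Longrightarrow> b \<noteq> 0 \<Longrightarrow> a + b \<noteq> 0 \<Longrightarrow> min (v a) (v b) \<le> v (a + b)"
    and uniformizer: "\<exists>\<pi>. \<pi> \<noteq> 0 \<and> v \<pi> = 1"
    and finite_residue_field: "finite (residue_field v)"
    and complete: "\<And>s :: nat \<Rightarrow> 'f.
                   (\<forall>r. \<exists>k. \<forall>m\<ge>k. \<forall>n\<ge>k. s m - s n \<in> frac_ideal v r) \<Longrightarrow>
                   \<exists>l. \<forall>r. \<exists>k. \<forall>n\<ge>k. s n - l \<in> frac_ideal v r"

definition padic_abs :: "('f::field \<Rightarrow> int) \<Rightarrow> 'f \<Rightarrow> real" where
  "padic_abs v a = (if a = 0 then 0 else real (card (residue_field v)) powi (- v a))"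

definition field_top :: "('f::field \<Rightarrow> int) \<Rightarrow> 'f topology" where
  "field_top v = topology_generated_by {(+) a ` frac_ideal v r | a r. True}"

definition matrix_top :: "('f::field \<Rightarrow> int) \<Rightarrow> ('f^'n^'n) topology" where
  "matrix_top v = pullback_topology UNIV (\<lambda>A (i, j). A $ i $ j)
                    (product_topology (\<lambda>_. field_top v) UNIV)"


section \<open>Linear algebraic groups\<close>

text \<open>Varieties over the infinite field \<open>F\<close> are given by their sets of \<open>F\<close>-points together with
  the algebra of regular functions on them. All varieties that occur (\<open>GL\<^sub>n\<close>, the additive
  group, split tori, split groups) have Zariski dense \<open>F\<close>-points.\<close>

definition GL :: "('f::field^'n^'n) monoid" where
  "GL = \<lparr>carrier = {A. invertible A}, mult = (**), one = mat 1\<rparr>"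

inductive_set algebra_gen :: "('a \<Rightarrow> 'f::field) set \<Rightarrow> ('a \<Rightarrow> 'f) set" for S where
  gen: "f \<in> S \<Longrightarrow> f \<in> algebra_gen S"
| const: "(\<lambda>_. c) \<in> algebra_gen S"
| add: "f \<in> algebra_gen S \<Longrightarrow> g \<in> algebra_gen S \<Longrightarrow> (\<lambda>a. f a + g a) \<in> algebra_gen S"
| mult: "f \<in> algebra_gen S \<Longrightarrow> g \<in> algebra_gen S \<Longrightarrow> (\<lambda>a. f a * g a) \<in> algebra_gen S"

definition regular_GL :: "('f::field^'n^'n \<Rightarrow> 'f) set" where
  "regular_GL = algebra_gen ({\<lambda>A. A $ i $ j | i j. True} \<union> {\<lambda>A. inverse (det A)})"

definition regular_line :: "('f::field \<Rightarrow> 'f) set" where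
  "regular_line = algebra_gen {\<lambda>t. t}"

definition torus :: "('f::field^'d) set" where
  "torus = {a. \<forall>i. a $ i \<noteq> 0}"

definition regular_torus :: "('f::field^'d \<Rightarrow> 'f) set" where
  "regular_torus = algebra_gen ({\<lambda>a. a $ i | i. True} \<union> {\<lambda>a. inverse (a $ i) | i. True})"

definition zariski_closed :: "('f::field^'n^'n) set \<Rightarrow> bool" where
  "zariski_closed G \<longleftrightarrow> (\<exists>S \<subseteq> regular_GL. G = {A. invertible A \<and> (\<forall>f\<in>S. f A = 0)})"

text \<open>\<open>f\<close> is a closed immersion of the affine variety \<open>X\<close> with coordinate ring \<open>R\<close> into \<open>GL\<^sub>n\<close>:
  the comorphism is well defined and maps onto \<open>R\<close>.\<close>

definition closed_immersion :: "'a set \<Rightarrow> ('a \<Rightarrow> 'f::field) set \<Rightarrow> ('a \<Rightarrow> 'f^'n^'n) \<Rightarrow> bool" where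
  "closed_immersion X R f \<longleftrightarrow> f ` X \<subseteq> carrier GL \<and>
     (\<lambda>g. restrict (g \<circ> f) X) ` regular_GL = (\<lambda>u. restrict u X) ` R"


section \<open>The root system of type \<open>E\<^sub>6\<close>\<close>

datatype node = N1 | N2 | N3 | N4 | N5 | N6

instance node :: finite
proof
  have "(UNIV :: node set) \<subseteq> {N1, N2, N3, N4, N5, N6}"
    by (auto intro: node.exhaust)
  then show "finite (UNIV :: node set)"
    by (rule finite_subset) simp
qed

definition cartan :: "node \<Rightarrow> node \<Rightarrow> int" where
  "cartan i j = (if i = j then 2
     else if {i, j} \<in> {{N1, N3}, {N3, N4}, {N4, N5}, {N5, N6}, {N2, N4}} then -1 else 0)"

text \<open>Elements of the root lattice are written in the basis of simple roots, elements of the coroot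
  lattice in the basis of simple coroots; \<open>pairing \<beta> \<lambda>\<close> is \<open>\<langle>\<beta>, \<lambda>\<rangle>\<close>.\<close>

definition pairing :: "int^node \<Rightarrow> int^node \<Rightarrow> int" where
  "pairing \<beta> l = (\<Sum>i\<in>UNIV. \<Sum>j\<in>UNIV. \<beta> $ i * cartan i j * l $ j)"

abbreviation simple :: "node \<Rightarrow> int^node" where
  "simple i \<equiv> axis i 1"

inductive_set roots :: "(int^node) set" where
  simple_root: "simple i \<in> roots"
| reflection: "\<beta> \<in> roots \<Longrightarrow> \<beta> - pairing \<beta> (simple i) *s simple i \<in> roots"

text \<open>All roots have the same length, so the coroot of \<open>\<Sum> m\<^sub>i \<alpha>\<^sub>i\<close> is \<open>\<Sum> m\<^sub>i \<alpha>\<^sub>i\<^sup>\<or>\<close>.\<close>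

definition coroot :: "int^node \<Rightarrow> int^node" where
  "coroot \<beta> = \<beta>"

definition positive_roots :: "(int^node) set" where
  "positive_roots = {\<beta>\<in>roots. \<forall>i. 0 \<le> \<beta> $ i}"

definition roots_M :: "(int^node) set" where
  "roots_M = {\<beta>\<in>roots. \<beta> $ N2 = 0}"

definition roots_M_pos :: "(int^node) set" where
  "roots_M_pos = roots_M \<inter> positive_roots"

definition roots_N :: "(int^node) set" where
  "roots_N = positive_roots - roots_M"

definition roots_N_neg :: "(int^node) set" where
  "roots_N_neg = uminus ` roots_N"

definition highest_root :: "int^node" where
  "highest_root = (\<chi> i. case i of N1 \<Rightarrow> 1 | N2 \<Rightarrow> 2 | N3 \<Rightarrow> 2 | N4 \<Rightarrow> 3 | N5 \<Rightarrow> 2 | N6 \<Rightarrow> 1)"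

definition two_rho_check :: "int^node" where
  "two_rho_check = (\<Sum>\<beta>\<in>positive_roots. coroot \<beta>)"


section \<open>The split simply connected group of type \<open>E\<^sub>6\<close> with a Chevalley system\<close>

text \<open>\<open>G\<close> is the group of \<open>F\<close>-points, in an arbitrary closed embedding into some \<open>GL\<^sub>n\<close>; \<open>h\<close>
  parametrizes the \<open>F\<close>-points of the maximal torus \<open>A\<close> by
  \<open>(t\<^sub>i) \<mapsto> \<Prod> \<alpha>\<^sub>i\<^sup>\<or>(t\<^sub>i)\<close>, so that its being an isomorphism onto \<open>A\<close> says that the cocharacter lattice
  is the coroot lattice, i.e. that \<open>G\<close> is simply connected; \<open>x \<beta>\<close> are the root
  subgroups.\<close>

definition root_char :: "int^node \<Rightarrow> 'f::field^node \<Rightarrow> 'f" where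
  "root_char \<beta> a = (\<Prod>i\<in>UNIV. (a $ i) powi pairing \<beta> (simple i))"

definition cochar :: "('f::field^node \<Rightarrow> 'f^'n^'n) \<Rightarrow> int^node \<Rightarrow> 'f \<Rightarrow> 'f^'n^'n" where
  "cochar h l t = h (\<chi> i. t powi (l $ i))"

definition weyl_elt :: "(int^node \<Rightarrow> 'f::field \<Rightarrow> 'f^'n^'n) \<Rightarrow> int^node \<Rightarrow> 'f \<Rightarrow> 'f^'n^'n" where
  "weyl_elt x \<beta> t = x \<beta> t ** x (- \<beta>) (- inverse t) ** x \<beta> t"

definition root_subgroups_generate ::
  "(int^node \<Rightarrow> 'f::field \<Rightarrow> 'f^'n^'n) \<Rightarrow> (int^node) set \<Rightarrow> ('f^'n^'n) set" where
  "root_subgroups_generate x S = generate GL (\<Union>\<beta>\<in>S. range (x \<beta>))"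

text \<open>In \<open>h_coroot\<close>, the pair \<open>x \<beta>\<close>, \<open>x (-\<beta>)\<close> is normalized as the upper and lower unipotent
  subgroups of \<open>SL\<^sub>2\<close>. Since \<open>E\<^sub>6\<close> is simply laced, \<open>\<alpha> + \<beta>\<close> is the only root of the form
  \<open>i\<alpha> + j\<beta>\<close> with \<open>i, j > 0\<close> that can occur in Chevalley's commutator formula.\<close>

locale split_sc_E6 =
  fixes G :: "('f::field_char_0^'n^'n) set"
    and h :: "'f^node \<Rightarrow> 'f^'n^'n"
    and x :: "int^node \<Rightarrow> 'f \<Rightarrow> 'f^'n^'n"
  assumes G_subgroup: "subgroup G GL"
    and G_closed: "zariski_closed G"
    and G_generated: "G = root_subgroups_generate x roots"
    and h_in_G: "a \<in> torus \<Longrightarrow> h a \<in> G"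
    and h_immersion: "closed_immersion torus regular_torus h"
    and h_mult: "a \<in> torus \<Longrightarrow> b \<in> torus \<Longrightarrow> h (a * b) = h a ** h b"
    and x_immersion: "\<beta> \<in> roots \<Longrightarrow> closed_immersion UNIV regular_line (x \<beta>)"
    and x_add: "\<beta> \<in> roots \<Longrightarrow> x \<beta> (s + t) = x \<beta> s ** x \<beta> t"
    and h_x: "a \<in> torus \<Longrightarrow> \<beta> \<in> roots \<Longrightarrow>
                h a ** x \<beta> t ** matrix_inv (h a) = x \<beta> (root_char \<beta> a * t)"
    and h_coroot: "\<beta> \<in> roots \<Longrightarrow> t \<noteq> 0 \<Longrightarrow>
                cochar h (coroot \<beta>) t = weyl_elt x \<beta> t ** matrix_inv (weyl_elt x \<beta> 1)"
    and commutator: "\<alpha> \<in> roots \<Longrightarrow> \<beta> \<in> roots \<Longrightarrow> \<alpha> + \<beta> \<in> roots \<Longrightarrow>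
                \<exists>c::int. \<forall>s t. x \<alpha> s ** x \<beta> t ** matrix_inv (x \<alpha> s) ** matrix_inv (x \<beta> t)
                             = x (\<alpha> + \<beta>) (of_int c * s * t)"
    and commute: "\<alpha> \<in> roots \<Longrightarrow> \<beta> \<in> roots \<Longrightarrow> \<alpha> + \<beta> \<notin> roots \<Longrightarrow> \<alpha> + \<beta> \<noteq> 0 \<Longrightarrow>
                x \<alpha> s ** x \<beta> t = x \<beta> t ** x \<alpha> s"

definition Levi_M ::
  "('f::field^node \<Rightarrow> 'f^'n^'n) \<Rightarrow> (int^node \<Rightarrow> 'f \<Rightarrow> 'f^'n^'n) \<Rightarrow> ('f^'n^'n) set" where
  "Levi_M h x = generate GL (h ` torus \<union> (\<Union>\<beta>\<in>roots_M. range (x \<beta>)))"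

definition center_M ::
  "('f::field^node \<Rightarrow> 'f^'n^'n) \<Rightarrow> (int^node \<Rightarrow> 'f \<Rightarrow> 'f^'n^'n) \<Rightarrow> ('f^'n^'n) set" where
  "center_M h x = {z \<in> Levi_M h x. \<forall>m \<in> Levi_M h x. z ** m = m ** z}"

definition Nbar :: "(int^node \<Rightarrow> 'f::field \<Rightarrow> 'f^'n^'n) \<Rightarrow> ('f^'n^'n) set" where
  "Nbar x = root_subgroups_generate x roots_N_neg"


section \<open>The lattice subgroups\<close>

definition root_lattice_subgroup ::
  "('f::field \<Rightarrow> int) \<Rightarrow> (int^node \<Rightarrow> 'f \<Rightarrow> 'f^'n^'n) \<Rightarrow> int^node \<Rightarrow> int \<Rightarrow> ('f^'n^'n) set" where
  "root_lattice_subgroup v x \<beta> r = x \<beta> ` frac_ideal v r"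

definition rbar :: "int \<Rightarrow> int^node \<Rightarrow> int" where
  "rbar k \<eta> = (if \<eta> = - highest_root then - 2 * k - pairing \<eta> two_rho_check
               else - k - pairing \<eta> two_rho_check)"

definition ordered_product :: "('f::field^'n^'n) set list \<Rightarrow> ('f^'n^'n) set" where
  "ordered_product Us = foldr (set_mult GL) Us {mat 1}"

text \<open>A total ordering of a finite set of roots is given by the list enumerating it.\<close>

definition is_ordering :: "(int^node) list \<Rightarrow> (int^node) set \<Rightarrow> bool" where
  "is_ordering bs S \<longleftrightarrow> distinct bs \<and> set bs = S"

definition Nbar0 ::
  "('f::field \<Rightarrow> int) \<Rightarrow> (int^node \<Rightarrow> 'f \<Rightarrow> 'f^'n^'n) \<Rightarrow> (int^node) list \<Rightarrow> int \<Rightarrow> ('f^'n^'n) set" where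
  "Nbar0 v x \<eta>s k = ordered_product (map (\<lambda>\<eta>. root_lattice_subgroup v x \<eta> (rbar k \<eta>)) \<eta>s)"

definition U0 ::
  "('f::field \<Rightarrow> int) \<Rightarrow> (int^node \<Rightarrow> 'f \<Rightarrow> 'f^'n^'n) \<Rightarrow> (int^node) list \<Rightarrow> ('f^'n^'n) set" where
  "U0 v x \<alpha>s =
     ordered_product (map (\<lambda>\<alpha>. root_lattice_subgroup v x \<alpha> (- pairing \<alpha> two_rho_check)) \<alpha>s)"

definition conjugate_set :: "'f::field^'n^'n \<Rightarrow> ('f^'n^'n) set \<Rightarrow> ('f^'n^'n) set" where
  "conjugate_set g S = (\<lambda>A. g ** A ** matrix_inv g) ` S"

end

theory Submission
  imports Defs
begin

text \<open>Write \<open>N\<close> for the unipotent group \<open>Nbar x\<close>. It is a Heisenberg group. Pairing with the highest root \<open>\<gamma>\<^sub>0\<close> is the coefficient of \<open>\<alpha>\<^sub>2\<close>,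
and on the roots of \<open>N\<close> this coefficient (the level) is \<open>-1\<close>, except that it is \<open>-2\<close> at \<open>-\<gamma>\<^sub>0\<close>.
Hence a sum of two roots of \<open>N\<close> can be a root only if it equals \<open>-\<gamma>\<^sub>0\<close>, and the root subgroup of
\<open>-\<gamma>\<^sub>0\<close> is central. The bounds in the definition of the lattice groups are affine in the
root, with \<open>\<kappa>\<close> multiplied by the level, so commutators of the factors land in the factor at \<open>-\<gamma>\<^sub>0\<close>.

For any family of additive subgroups with this commutator property, the ordered product of
the root subgroups is the group that they generate: a generator can be moved to its place at the
cost of a factor at \<open>-\<gamma>\<^sub>0\<close> (\<open>root_product_eq_generate\<close>). Applied to the ideals this gives the
lattice groups, applied to the whole field it gives \<open>N\<close>. Inclusion and exhaustion are then
read off the factors. Elements of \<open>U\<^sub>0\<close> normalize because conjugation by \<open>x\<^sub>\<alpha>(s)\<close>, with \<open>\<alpha>\<close> of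
level \<open>0\<close>, keeps the level and changes the bound by \<open>-\<alpha>(x)\<close> (\<open>conjugate_Nbar0_subset\<close>), and
conjugation by \<open>\<gamma>\<^sub>0\<^sup>\<or>(t)\<close> multiplies the coordinate at \<open>\<eta>\<close> by \<open>t\<close> to the power of the level of \<open>\<eta>\<close>.

Compactness holds because the fractional ideals are compact and the \<open>x\<^sub>\<eta>\<close> are polynomial. Openness
is the delicate point: the coordinates of an element of \<open>N\<close> must be continuous for the topology
of the ambient matrix space. They are regular functions. For \<open>\<eta> \<noteq> -\<gamma>\<^sub>0\<close> the difference
\<open>\<gamma> = -\<gamma>\<^sub>0 - \<eta>\<close> is again a root, and the commutator of \<open>x\<^sub>\<gamma>(1)\<close> with an element whose coordinate at \<open>\<eta>\<close>
is \<open>a\<close> is \<open>x\<close> at \<open>-\<gamma>\<^sub>0\<close> with argument \<open>c a\<close>, for a structure constant \<open>c\<close>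
(\<open>complementary_commutator\<close>); a regular function on \<open>GL\<^sub>n\<close> that inverts the closed immersion
of this root subgroup recovers \<open>a\<close>, provided \<open>c \<noteq> 0\<close>. Were \<open>c\<close> zero, the whole \<open>SL\<^sub>2\<close> of \<open>\<gamma>\<close> would
commute with \<open>x\<^sub>\<eta>\<close>, although its torus acts there through a nontrivial character
(\<open>structure_constant\<close>). The last coordinate is found after dividing by the other factors.\<close>

section \<open>The root system\<close>

lemma UNIV_node: "(UNIV :: node set) = {N1, N2, N3, N4, N5, N6}"
  by (auto intro: node.exhaust)

lemma node_all: "(\<forall>i. P i) \<longleftrightarrow> P N1 \<and> P N2 \<and> P N3 \<and> P N4 \<and> P N5 \<and> P N6"
  by (metis node.exhaust)

lemma pairing_explicit:
  "pairing \<beta> l = 2 * (\<beta>$N1 * l$N1 + \<beta>$N2 * l$N2 + \<beta>$N3 * l$N3 + \<beta>$N4 * l$N4 + \<beta>$N5 * l$N5 + \<beta>$N6 * l$N6)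
     - (\<beta>$N1 * l$N3 + \<beta>$N3 * l$N1 + \<beta>$N3 * l$N4 + \<beta>$N4 * l$N3 + \<beta>$N4 * l$N5 + \<beta>$N5 * l$N4
        + \<beta>$N5 * l$N6 + \<beta>$N6 * l$N5 + \<beta>$N2 * l$N4 + \<beta>$N4 * l$N2)"
  unfolding pairing_def UNIV_node by (simp add: cartan_def doubleton_eq_iff)

lemma pairing_commute: "pairing \<beta> l = pairing l \<beta>"
  by (simp add: pairing_explicit algebra_simps)

lemma pairing_left_linear:
  "pairing (a + b) l = pairing a l + pairing b l"
  "pairing (a - b) l = pairing a l - pairing b l"
  "pairing (- a) l = - pairing a l"
  "pairing (c *s a) l = c * pairing a l"
  by (simp_all add: pairing_explicit algebra_simps)

lemma pairing_right_linear:
  "pairing l (a + b) = pairing l a + pairing l b"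
  "pairing l (a - b) = pairing l a - pairing l b"
  "pairing l (- a) = - pairing l a"
  "pairing l (c *s a) = c * pairing l a"
  by (simp_all add: pairing_explicit algebra_simps)

lemmas pairing_linear = pairing_left_linear pairing_right_linear

text \<open>The square completion of the \<open>E\<^sub>6\<close> form from the three ends of the diagram towards the branch
node \<open>N4\<close>; it makes positive definiteness visible.\<close>

lemma pairing_sum_of_squares:
  "6 * pairing \<beta> \<beta> = 3 * (2 * \<beta>$N1 - \<beta>$N3)\<^sup>2 + 3 * (2 * \<beta>$N6 - \<beta>$N5)\<^sup>2 + 3 * (2 * \<beta>$N2 - \<beta>$N4)\<^sup>2
     + (3 * \<beta>$N3 - 2 * \<beta>$N4)\<^sup>2 + (3 * \<beta>$N5 - 2 * \<beta>$N4)\<^sup>2 + (\<beta>$N4)\<^sup>2"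
  by (simp add: pairing_explicit power2_eq_square algebra_simps)

lemma pairing_nonneg: "0 \<le> pairing \<beta> \<beta>"
proof -
  have "0 \<le> 6 * pairing \<beta> \<beta>"
    unfolding pairing_sum_of_squares by simp
  then show ?thesis by simp
qed

lemma pairing_self_eq_0:
  assumes "pairing \<beta> \<beta> = 0" shows "\<beta> = 0"
proof -
  define a b c d e f where defs: "a = (2 * \<beta>$N1 - \<beta>$N3)\<^sup>2" "b = (2 * \<beta>$N6 - \<beta>$N5)\<^sup>2"
    "c = (2 * \<beta>$N2 - \<beta>$N4)\<^sup>2" "d = (3 * \<beta>$N3 - 2 * \<beta>$N4)\<^sup>2" "e = (3 * \<beta>$N5 - 2 * \<beta>$N4)\<^sup>2" "f = (\<beta>$N4)\<^sup>2"
  have "a \<ge> 0" "b \<ge> 0" "c \<ge> 0" "d \<ge> 0" "e \<ge> 0" "f \<ge> 0"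
    by (simp_all add: defs)
  moreover have "0 = 3 * a + 3 * b + 3 * c + d + e + f"
    using pairing_sum_of_squares[of \<beta>] assms by (simp add: defs)
  ultimately have "a = 0" "b = 0" "c = 0" "d = 0" "e = 0" "f = 0"
    by linarith+
  then show ?thesis
    unfolding defs by (simp add: vec_eq_iff node_all)
qed

lemma pairing_self_ge_2:
  assumes "\<beta> \<noteq> 0" shows "2 \<le> pairing \<beta> \<beta>"
proof -
  have "pairing \<beta> \<beta> \<noteq> 0" "0 \<le> pairing \<beta> \<beta>" 
    using assms pairing_self_eq_0 pairing_nonneg by blast+
  moreover have "even (pairing \<beta> \<beta>)"
    by (simp add: pairing_explicit)
  ultimately show ?thesis by presburger
qed


lemma pairing_simple_simple: "pairing (simple i) (simple i) = 2"
  by (cases i) (simp_all add: pairing_explicit axis_def)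

subsection \<open>Roots\<close>

lemma root_norm: "\<beta> \<in> roots \<Longrightarrow> pairing \<beta> \<beta> = 2"
proof (induction rule: roots.induct)
  case (simple_root i)
  show ?case by (rule pairing_simple_simple)
next
  case (reflection \<beta> i)
  then show ?case
    by (simp add: pairing_linear pairing_simple_simple pairing_commute algebra_simps)
qed

lemma zero_not_root: "0 \<notin> roots"
  using root_norm[of 0] by (auto simp: pairing_explicit)

lemma root_uminus: "\<beta> \<in> roots \<Longrightarrow> - \<beta> \<in> roots"
proof (induction rule: roots.induct)
  case (simple_root i)
  have "simple i - pairing (simple i) (simple i) *s simple i \<in> roots"
    by (intro roots.intros)
  moreover have "simple i - pairing (simple i) (simple i) *s simple i = - simple i"
    by (simp add: pairing_simple_simple vec_eq_iff)
  ultimately show ?case by simp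
next
  case (reflection \<beta> i)
  have "- \<beta> - pairing (- \<beta>) (simple i) *s simple i \<in> roots"
    by (intro roots.reflection reflection)
  moreover have "- \<beta> - pairing (- \<beta>) (simple i) *s simple i = - (\<beta> - pairing \<beta> (simple i) *s simple i)"
    by (simp add: pairing_linear vec_eq_iff)
  ultimately show ?case by simp
qed

text \<open>The definition of the roots only provides the simple reflections. The general case is carried along
the orbit by \<open>s\<^bsub>s\<^sub>i\<beta>\<^esub> = s\<^sub>i s\<^sub>\<beta> s\<^sub>i\<close>.\<close>

lemma root_reflection:
  "\<beta> \<in> roots \<Longrightarrow> \<gamma> \<in> roots \<Longrightarrow> \<gamma> - pairing \<gamma> \<beta> *s \<beta> \<in> roots"
proof (induction arbitrary: \<gamma> rule: roots.induct)
  case (simple_root i)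
  then show ?case by (rule roots.reflection)
next
  case (reflection \<beta> i)
  define s where "s a = a - pairing a (simple i) *s simple i" for a
  have s_roots: "s a \<in> roots" if "a \<in> roots" for a
    unfolding s_def using that by (rule roots.reflection)
  have "s (s \<gamma> - pairing (s \<gamma>) \<beta> *s \<beta>) \<in> roots"
    by (intro s_roots reflection.IH reflection.prems)
  moreover have "s (s \<gamma> - pairing (s \<gamma>) \<beta> *s \<beta>) = \<gamma> - pairing \<gamma> (s \<beta>) *s s \<beta>"
    by (simp add: s_def vec_eq_iff pairing_linear pairing_simple_simple pairing_commute[of \<beta> "simple i"] pairing_commute[of \<gamma> "simple i"] algebra_simps)
  ultimately have "\<gamma> - pairing \<gamma> (s \<beta>) *s s \<beta> \<in> roots"
    by (simp only:)
  then show ?case unfolding s_def .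
qed

text \<open>Split \<open>\<beta> = P - Q\<close> into its positive and negative part. The off-diagonal entries of the Cartan matrix
are nonpositive and the supports are disjoint, so \<open>(P, Q) \<le> 0\<close>; if both parts were nonzero, then
\<open>(\<beta>, \<beta>) \<ge> (P, P) + (Q, Q) \<ge> 4\<close>, whereas roots have norm \<open>2\<close>.\<close>

lemma root_sign:
  assumes "\<beta> \<in> roots"
  shows "(\<forall>i. 0 \<le> \<beta> $ i) \<or> (\<forall>i. \<beta> $ i \<le> 0)"
proof -
  define P Q :: "int^node" where "P = (\<chi> i. max (\<beta> $ i) 0)" and "Q = (\<chi> i. max (- \<beta> $ i) 0)"
  have \<beta>: "\<beta> = P - Q"
    by (simp add: P_def Q_def vec_eq_iff max_def)
  have disjoint: "P $ i * Q $ i = 0" and nonneg: "P $ i * Q $ j \<ge> 0" for i j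
    by (simp_all add: P_def Q_def max_def)
  have "pairing P Q \<le> 0"
    unfolding pairing_explicit using nonneg[of N1 N3] nonneg[of N3 N1] nonneg[of N3 N4] nonneg[of N4 N3]
      nonneg[of N4 N5] nonneg[of N5 N4] nonneg[of N5 N6] nonneg[of N6 N5] nonneg[of N2 N4] nonneg[of N4 N2]
    by (simp add: disjoint)
  moreover have "pairing P P + pairing Q Q - 2 * pairing P Q = 2"
    using root_norm[OF assms] by (simp add: \<beta> pairing_linear pairing_commute)
  ultimately have "P = 0 \<or> Q = 0"
    using pairing_self_ge_2[of P] pairing_self_ge_2[of Q] by fastforce
  then show ?thesis
  proof
    assume "P = 0"
    then have "max (\<beta> $ i) 0 = 0" for i
      by (metis P_def vec_lambda_beta zero_index)
    then show ?thesis by (metis max.cobounded1)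
  next
    assume "Q = 0"
    then have "max (- \<beta> $ i) 0 = 0" for i
      by (metis Q_def vec_lambda_beta zero_index)
    then show ?thesis by (metis max.cobounded1 neg_le_0_iff_le)
  qed
qed

text \<open>The highest root of \<open>E\<^sub>6\<close> is the fundamental weight dual to \<open>\<alpha>\<^sub>2\<close>.\<close>

lemma pairing_highest_root: "pairing \<beta> highest_root = \<beta> $ N2"
  by (simp add: pairing_explicit highest_root_def)

text \<open>Both facts come from \<open>(\<beta> - \<gamma>\<^sub>0, \<beta> - \<gamma>\<^sub>0) = 4 - 2 (\<beta>, \<gamma>\<^sub>0)\<close> and positive definiteness, so the roots need not
be enumerated.\<close>

lemma root_level_le_2:
  assumes "\<beta> \<in> roots" shows "\<beta> $ N2 \<le> 2" and "\<beta> $ N2 = 2 \<Longrightarrow> \<beta> = highest_root"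
proof -
  have "pairing (\<beta> - highest_root) (\<beta> - highest_root) = 4 - 2 * \<beta> $ N2"
    using root_norm[OF assms]
    by (simp add: pairing_linear pairing_highest_root pairing_commute[of highest_root \<beta>])
       (simp add: highest_root_def)
  then show "\<beta> $ N2 \<le> 2" "\<beta> $ N2 = 2 \<Longrightarrow> \<beta> = highest_root"
    using pairing_nonneg[of "\<beta> - highest_root"] pairing_self_eq_0[of "\<beta> - highest_root"] by simp_all
qed

lemma roots_N_neg_iff: "\<beta> \<in> roots_N_neg \<longleftrightarrow> \<beta> \<in> roots \<and> \<beta> $ N2 < 0"
proof
  assume "\<beta> \<in> roots_N_neg"
  then obtain \<gamma> where "\<beta> = - \<gamma>" "\<gamma> \<in> roots" "\<forall>i. 0 \<le> \<gamma> $ i" "\<gamma> $ N2 \<noteq> 0"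
    by (auto simp: roots_N_neg_def roots_N_def positive_roots_def roots_M_def)
  then show "\<beta> \<in> roots \<and> \<beta> $ N2 < 0"
    using root_uminus by (simp add: less_le)
next
  assume \<beta>: "\<beta> \<in> roots \<and> \<beta> $ N2 < 0"
  then have "\<forall>i. \<beta> $ i \<le> 0"
    using root_sign[of \<beta>] by (meson leD)
  with \<beta> have "- \<beta> \<in> roots_N"
    using root_uminus[of \<beta>] by (auto simp: roots_N_def positive_roots_def roots_M_def)
  then show "\<beta> \<in> roots_N_neg"
    unfolding roots_N_neg_def by (metis image_eqI minus_minus)
qed

lemma roots_N_neg_level:
  assumes "\<beta> \<in> roots_N_neg"
  shows "\<beta> $ N2 = (if \<beta> = - highest_root then - 2 else - 1)"
proof -
  have \<beta>: "- \<beta> \<in> roots" "\<beta> $ N2 < 0"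
    using assms root_uminus by (auto simp: roots_N_neg_iff)
  show ?thesis
  proof (cases "\<beta> = - highest_root")
    case True then show ?thesis by (simp add: highest_root_def)
  next
    case False
    then have "- \<beta> \<noteq> highest_root" by (metis minus_minus)
    then have "(- \<beta>) $ N2 \<noteq> 2" "(- \<beta>) $ N2 \<le> 2"
      using root_level_le_2[OF \<beta>(1)] by blast+
    then show ?thesis
      using False \<beta>(2) by simp
  qed
qed

text \<open>The reflection in \<open>\<beta>\<close> sends \<open>-\<gamma>\<^sub>0\<close> to \<open>-\<gamma>\<^sub>0 - \<beta>\<close>. Thus every root of level \<open>-1\<close> has a partner with which
it fails to commute.\<close>

lemma highest_root_complement:
  assumes "\<beta> \<in> roots_N_neg" "\<beta> \<noteq> - highest_root" "- highest_root \<in> roots_N_neg"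
  shows "- highest_root - \<beta> \<in> roots_N_neg"
proof -
  have \<beta>: "\<beta> $ N2 = - 1" "\<beta> \<in> roots" "- highest_root \<in> roots"
    using assms roots_N_neg_level[of \<beta>] by (auto simp: roots_N_neg_iff)
  have "pairing (- highest_root) \<beta> = 1"
    using \<beta> by (simp add: pairing_linear pairing_commute[of highest_root] pairing_highest_root)
  then have "- highest_root - \<beta> \<in> roots"
    using root_reflection[OF \<beta>(2) \<beta>(3)] by simp
  moreover have "(- highest_root - \<beta>) $ N2 = - 1"
    using \<beta> by (simp add: highest_root_def)
  ultimately show ?thesis by (simp add: roots_N_neg_iff)
qed

lemma roots_N_neg_sum:
  assumes "\<alpha> \<in> roots_N_neg" "\<beta> \<in> roots_N_neg" "\<alpha> + \<beta> \<in> roots"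
  shows "\<alpha> + \<beta> = - highest_root" "\<alpha> \<noteq> - highest_root" "\<beta> \<noteq> - highest_root"
proof -
  have "\<alpha> $ N2 < 0" "\<beta> $ N2 < 0"
    using assms by (auto simp: roots_N_neg_iff)
  then have sum: "\<alpha> + \<beta> \<in> roots_N_neg"
    using assms by (simp add: roots_N_neg_iff)
  show "\<alpha> + \<beta> = - highest_root" "\<alpha> \<noteq> - highest_root" "\<beta> \<noteq> - highest_root"
    using roots_N_neg_level[OF sum] roots_N_neg_level[OF assms(1)] roots_N_neg_level[OF assms(2)]
    by (auto split: if_splits simp: highest_root_def)
qed

lemma roots_N_neg_add_nonzero:
  assumes "\<alpha> \<in> roots_N_neg" "\<beta> \<in> roots_N_neg"
  shows "\<alpha> + \<beta> \<noteq> 0"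
proof
  assume "\<alpha> + \<beta> = 0"
  then have "(\<alpha> + \<beta>) $ N2 = 0" by simp
  then show False using assms by (simp add: roots_N_neg_iff)
qed

lemma minus_simple_in_roots_N_neg: "- simple N2 \<in> roots_N_neg"
  by (simp add: roots_N_neg_iff root_uminus roots.simple_root)

text \<open>If \<open>\<alpha>\<close>, \<open>\<beta>\<close> and \<open>\<alpha> + \<beta>\<close> all have norm \<open>2\<close>, then \<open>\<beta> - \<alpha>\<close> has norm \<open>6\<close>. Consequently \<open>x\<^bsub>-\<alpha>\<^esub>\<close> commutes with
\<open>x\<^sub>\<beta>\<close>.\<close>

lemma root_sum_diff:
  assumes "\<alpha> \<in> roots" "\<beta> \<in> roots" "\<alpha> + \<beta> \<in> roots"
  shows "pairing \<beta> \<alpha> = - 1" "- \<alpha> + \<beta> \<notin> roots" "- \<alpha> + \<beta> \<noteq> 0"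
proof -
  show *: "pairing \<beta> \<alpha> = - 1"
    using assms[THEN root_norm] by (simp add: pairing_linear pairing_commute[of \<alpha> \<beta>])
  show "- \<alpha> + \<beta> \<notin> roots"
    using root_norm[of "- \<alpha> + \<beta>"] assms[THEN root_norm] *
    by (auto simp: pairing_linear pairing_commute[of \<alpha> \<beta>])
  show "- \<alpha> + \<beta> \<noteq> 0"
    using * root_norm[OF assms(1)] by (auto simp: add_eq_0_iff)
qed

section \<open>The general linear group\<close>

lemma matrix_inv_right: "invertible A \<Longrightarrow> A ** matrix_inv A = mat 1"
  and matrix_inv_left: "invertible A \<Longrightarrow> matrix_inv A ** A = mat 1"
  for A :: "'f::semiring_1^'n^'n"
  using someI_ex[of "\<lambda>A'. A ** A' = mat 1 \<and> A' ** A = mat 1"]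
  by (auto simp: invertible_def matrix_inv_def)

lemma carrier_GL [simp]: "A \<in> carrier GL \<longleftrightarrow> invertible A"
  and mult_GL [simp]: "A \<otimes>\<^bsub>GL\<^esub> B = A ** B"
  and one_GL [simp]: "\<one>\<^bsub>GL\<^esub> = mat 1"
  by (simp_all add: GL_def)

lemma invertible_matrix_inv: "invertible A \<Longrightarrow> invertible (matrix_inv A)"
  for A :: "'f::field^'n^'n"
  using matrix_inv_right[of A] matrix_inv_left[of A] by (auto simp: invertible_def)

lemma group_GL: "group (GL :: ('f::field^'n^'n) monoid)"
proof (rule groupI)
  fix A :: "'f^'n^'n" assume "A \<in> carrier GL"
  then show "\<exists>B\<in>carrier GL. B \<otimes>\<^bsub>GL\<^esub> A = \<one>\<^bsub>GL\<^esub>"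
    using matrix_inv_left[of A] invertible_matrix_inv[of A] by (intro bexI[of _ "matrix_inv A"]) simp_all
qed (simp_all add: invertible_mult matrix_mul_assoc, simp add: invertible_def exI[of _ "mat 1"])

interpretation GL: group "GL :: ('f::field^'n^'n) monoid"
  by (rule group_GL)

lemma inv_GL: "invertible A \<Longrightarrow> inv\<^bsub>GL\<^esub> A = matrix_inv A"
  for A :: "'f::field^'n^'n"
  using matrix_inv_left[of A] invertible_matrix_inv[of A] by (intro GL.inv_equality) simp_all

lemma matrix_inv_unique: "A ** B = mat 1 \<Longrightarrow> matrix_inv A = B"
  for A :: "'f::field^'n^'n"
proof -
  assume AB: "A ** B = mat 1"
  then have "B ** A = mat 1" by (simp add: matrix_left_right_inverse)
  then have "invertible A" using AB by (auto simp: invertible_def)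
  then have "matrix_inv A ** (A ** B) = B"
    by (simp add: matrix_mul_assoc matrix_inv_left)
  then show ?thesis by (simp add: AB)
qed

lemma commute_matrix_inv:
  fixes A C :: "'f::field^'n^'n"
  assumes "invertible A" "C ** A = A ** C"
  shows "C ** matrix_inv A = matrix_inv A ** C"
proof -
  have "matrix_inv A ** (C ** A) ** matrix_inv A = matrix_inv A ** (A ** C) ** matrix_inv A"
    by (simp only: assms(2))
  moreover have "matrix_inv A ** (C ** A) ** matrix_inv A = matrix_inv A ** C ** (A ** matrix_inv A)"
    "matrix_inv A ** (A ** C) ** matrix_inv A = (matrix_inv A ** A) ** C ** matrix_inv A"
    by (simp_all only: matrix_mul_assoc)
  ultimately show ?thesis
    using assms(1) by (simp add: matrix_inv_left matrix_inv_right)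
qed

lemma conjugate_eq_iff:
  fixes A B :: "'f::field^'n^'n"
  assumes "invertible A"
  shows "A ** B ** matrix_inv A = C \<longleftrightarrow> A ** B = C ** A"
proof
  assume "A ** B ** matrix_inv A = C"
  then have "C ** A = A ** B ** (matrix_inv A ** A)" by (simp only: matrix_mul_assoc flip: \<open>_ = C\<close>)
  then show "A ** B = C ** A" using assms by (simp add: matrix_inv_left)
next
  assume "A ** B = C ** A"
  then have "A ** B ** matrix_inv A = C ** (A ** matrix_inv A)" by (simp only: matrix_mul_assoc)
  then show "A ** B ** matrix_inv A = C" using assms by (simp add: matrix_inv_right)
qed

lemma conjugate_mult:
  fixes g :: "'f::field^'n^'n"
  assumes "invertible g"
  shows "g ** (A ** B) ** matrix_inv g = (g ** A ** matrix_inv g) ** (g ** B ** matrix_inv g)"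
proof -
  have "(g ** A ** matrix_inv g) ** (g ** B ** matrix_inv g)
      = g ** A ** (matrix_inv g ** g) ** B ** matrix_inv g"
    by (simp only: matrix_mul_assoc)
  then show ?thesis
    using assms by (simp add: matrix_inv_left matrix_mul_assoc)
qed

lemma conjugate_set_mult:
  fixes a b :: "'f::field^'n^'n"
  assumes "invertible a" "invertible b"
  shows "conjugate_set (a ** b) S = conjugate_set a (conjugate_set b S)"
proof -
  have "(a ** b) ** (matrix_inv b ** matrix_inv a) = a ** (b ** matrix_inv b) ** matrix_inv a"
    by (simp only: matrix_mul_assoc)
  then have "matrix_inv (a ** b) = matrix_inv b ** matrix_inv a"
    using assms by (intro matrix_inv_unique) (simp add: matrix_inv_right)
  then show ?thesis
    by (simp add: conjugate_set_def image_image matrix_mul_assoc)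
qed

text \<open>Conjugation being a homomorphism, inclusions between generated groups need only be tested
on generators.\<close>

lemma conjugate_set_generate_subset:
  fixes g :: "'f::field^'n^'n"
  assumes g: "invertible g" and S: "S \<subseteq> carrier GL"
    and into: "\<And>A. A \<in> S \<Longrightarrow> g ** A ** matrix_inv g \<in> generate GL T" and T: "T \<subseteq> carrier GL"
  shows "conjugate_set g (generate GL S) \<subseteq> generate GL T"
proof -
  have "group_hom GL GL (\<lambda>A. g ** A ** matrix_inv g)"
    using g by unfold_locales
      (auto simp: hom_def invertible_mult invertible_matrix_inv conjugate_mult)
  then have "conjugate_set g (generate GL S) = generate GL ((\<lambda>A. g ** A ** matrix_inv g) ` S)"
    unfolding conjugate_set_def using S by (rule group_hom.generate_img[symmetric])
  also have "\<dots> \<subseteq> generate GL T"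
    using into by (intro GL.generate_subgroup_incl GL.generate_is_subgroup T) blast
  finally show ?thesis .
qed

lemma conjugate_set_eqI:
  fixes g :: "'f::field^'n^'n"
  assumes g: "invertible g"
    and sub: "conjugate_set g S \<subseteq> S" and inv_sub: "conjugate_set (matrix_inv g) S \<subseteq> S"
  shows "conjugate_set g S = S"
proof
  show "S \<subseteq> conjugate_set g S"
  proof
    fix A assume "A \<in> S"
    then have "matrix_inv g ** A ** matrix_inv (matrix_inv g) \<in> S"
      using inv_sub by (auto simp: conjugate_set_def)
    moreover have "matrix_inv (matrix_inv g) = g"
      using g by (intro matrix_inv_unique matrix_inv_left)
    ultimately have "matrix_inv g ** A ** g \<in> S" by simp
    moreover have "g ** (matrix_inv g ** A ** g) ** matrix_inv g
        = (g ** matrix_inv g) ** A ** (g ** matrix_inv g)"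
      by (simp only: matrix_mul_assoc)
    then have "A = g ** (matrix_inv g ** A ** g) ** matrix_inv g"
      using g by (simp add: matrix_inv_right)
    ultimately show "A \<in> conjugate_set g S"
      unfolding conjugate_set_def by blast
  qed
qed (rule sub)

lemma ordered_product_Nil [simp]: "ordered_product [] = {mat 1}"
  by (simp add: ordered_product_def)

lemma ordered_product_Cons [simp]: "ordered_product (U # Us) = U <#>\<^bsub>GL\<^esub> ordered_product Us"
  by (simp add: ordered_product_def)

lemma mem_set_mult_GL: "A \<in> S <#>\<^bsub>GL\<^esub> T \<longleftrightarrow> (\<exists>B\<in>S. \<exists>C\<in>T. A = B ** C)"
  by (auto simp: set_mult_def)

lemma conjugate_set_set_mult:
  fixes g :: "'f::field^'n^'n"
  assumes "invertible g"
  shows "conjugate_set g (S <#>\<^bsub>GL\<^esub> T) = conjugate_set g S <#>\<^bsub>GL\<^esub> conjugate_set g T"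
  unfolding conjugate_set_def set_mult_def
  by (simp add: image_UN conjugate_mult[OF assms])

lemma conjugate_set_ordered_product:
  fixes g :: "'f::field^'n^'n"
  assumes "invertible g"
  shows "conjugate_set g (ordered_product Us) = ordered_product (map (conjugate_set g) Us)"
proof (induction Us)
  case Nil
  then show ?case
    using assms by (simp add: conjugate_set_def matrix_inv_right)
next
  case (Cons U Us)
  then show ?case
    by (simp add: conjugate_set_set_mult[OF assms])
qed

lemma ordered_product_mono:
  assumes "list_all2 (\<subseteq>) Us Vs"
  shows "ordered_product Us \<subseteq> ordered_product Vs"
  using assms
proof induction
  case (Cons U Us V Vs)
  then show ?case
    unfolding ordered_product_Cons set_mult_def by (intro UN_mono subset_refl)
qed simp

lemma ordered_product_in_subgroup:
  assumes "subgroup H GL" "\<And>U. U \<in> set Us \<Longrightarrow> U \<subseteq> H"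
  shows "ordered_product Us \<subseteq> H"
  using assms(2)
proof (induction Us)
  case Nil
  then show ?case using subgroup.one_closed[OF assms(1)] by simp
next
  case (Cons U Us)
  have "B ** C \<in> H" if "B \<in> U" "C \<in> ordered_product Us" for B C
    using subgroup.m_closed[OF assms(1), of B C] Cons that by auto
  then show ?case by (auto simp: mem_set_mult_GL)
qed

section \<open>The topology of a p-adic field\<close>

context p_adic_field
begin

lemma v_one: "v 1 = 0"
  using v_mult[of 1 1] by simp

lemma v_minus_one: "v (- 1) = 0"
  using v_mult[of "- 1" "- 1"] v_one by simp

lemma v_minus: "v (- a) = v a"
  using v_mult[of "- 1" a] v_minus_one by (cases "a = 0") auto

lemma v_inverse: "a \<noteq> 0 \<Longrightarrow> v (inverse a) = - v a"
  using v_mult[of a "inverse a"] v_one by simp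

lemma v_power: "a \<noteq> 0 \<Longrightarrow> v (a ^ n) = int n * v a"
  by (induction n) (simp_all add: v_one v_mult algebra_simps)

lemma v_powi: "a \<noteq> 0 \<Longrightarrow> v (a powi k) = k * v a"
  by (simp add: power_int_def v_power v_inverse)

lemma zero_in_frac_ideal: "0 \<in> frac_ideal v r"
  by (simp add: frac_ideal_def)

lemma self_in_frac_ideal: "a \<in> frac_ideal v (v a)"
  by (simp add: frac_ideal_def)

lemma frac_ideal_antimono: "r \<le> s \<Longrightarrow> frac_ideal v s \<subseteq> frac_ideal v r"
  by (auto simp: frac_ideal_def)

lemma frac_ideal_add: "a \<in> frac_ideal v r \<Longrightarrow> b \<in> frac_ideal v r \<Longrightarrow> a + b \<in> frac_ideal v r"
  unfolding frac_ideal_def using v_add[of a b] by fastforce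

lemma frac_ideal_uminus: "a \<in> frac_ideal v r \<Longrightarrow> - a \<in> frac_ideal v r"
  unfolding frac_ideal_def using v_minus[of a] by auto

lemma frac_ideal_diff: "a \<in> frac_ideal v r \<Longrightarrow> b \<in> frac_ideal v r \<Longrightarrow> a - b \<in> frac_ideal v r"
  using frac_ideal_add[OF _ frac_ideal_uminus] by fastforce

lemma frac_ideal_mult: "a \<in> frac_ideal v r \<Longrightarrow> b \<in> frac_ideal v s \<Longrightarrow> a * b \<in> frac_ideal v (r + s)"
  unfolding frac_ideal_def using v_mult[of a b] by (cases "a = 0"; cases "b = 0") auto

lemma of_int_in_frac_ideal: "of_int c \<in> frac_ideal v 0"
proof -
  have *: "of_nat n \<in> frac_ideal v 0" for n
  proof (induction n)
    case (Suc n)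
    then show ?case
      using frac_ideal_add[of 1 0 "of_nat n"] v_one by (simp add: frac_ideal_def)
  qed (simp add: zero_in_frac_ideal)
  show ?thesis
    using *[of "nat c"] frac_ideal_uminus[OF *[of "nat (- c)"]] by (cases "0 \<le> c") auto
qed

lemma scale_frac_ideal:
  assumes "c \<noteq> 0"
  shows "(*) c ` frac_ideal v r = frac_ideal v (r + v c)"
proof
  show "(*) c ` frac_ideal v r \<subseteq> frac_ideal v (r + v c)"
    using assms frac_ideal_mult[OF self_in_frac_ideal[of c]] by (auto simp: add.commute)
  show "frac_ideal v (r + v c) \<subseteq> (*) c ` frac_ideal v r"
  proof
    fix a assume a: "a \<in> frac_ideal v (r + v c)"
    then have "inverse c * a \<in> frac_ideal v r"
      using frac_ideal_mult[OF self_in_frac_ideal[of "inverse c"] a] assms by (simp add: v_inverse)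
    then show "a \<in> (*) c ` frac_ideal v r"
      using assms by (intro image_eqI[of _ _ "inverse c * a"]) simp_all
  qed
qed

lemma openin_field_top:
  "openin (field_top v) U \<longleftrightarrow> (\<forall>a\<in>U. \<exists>r. (+) a ` frac_ideal v r \<subseteq> U)"
proof
  assume "openin (field_top v) U"
  then have "generate_topology_on {(+) a ` frac_ideal v r | a r. True} U"
    by (simp add: field_top_def openin_topology_generated_by_iff)
  then show "\<forall>a\<in>U. \<exists>r. (+) a ` frac_ideal v r \<subseteq> U"
  proof induction
    case (Int S T)
    show ?case
    proof
      fix a assume "a \<in> S \<inter> T"
      then obtain r s where "(+) a ` frac_ideal v r \<subseteq> S" "(+) a ` frac_ideal v s \<subseteq> T"
        using Int by blast
      then have "(+) a ` frac_ideal v (max r s) \<subseteq> S \<inter> T"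
        using frac_ideal_antimono[of r "max r s"] frac_ideal_antimono[of s "max r s"]
        by (simp add: image_subset_iff) blast
      then show "\<exists>r. (+) a ` frac_ideal v r \<subseteq> S \<inter> T" ..
    qed
  next
    case (UN K)
    then show ?case by (meson Union_iff Sup_upper order_trans)
  next
    case (Basis S)
    then obtain b r where S: "S = (+) b ` frac_ideal v r" by blast
    show ?case
    proof
      fix a assume "a \<in> S"
      then have "(+) a ` frac_ideal v r \<subseteq> S"
        using frac_ideal_add by (auto simp: S add.assoc)
      then show "\<exists>r. (+) a ` frac_ideal v r \<subseteq> S" ..
    qed
  qed auto
next
  assume *: "\<forall>a\<in>U. \<exists>r. (+) a ` frac_ideal v r \<subseteq> U"
  let ?K = "{(+) a ` frac_ideal v r | a r. (+) a ` frac_ideal v r \<subseteq> U}"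
  have "U \<subseteq> \<Union>?K"
  proof
    fix a assume "a \<in> U"
    then obtain r where "(+) a ` frac_ideal v r \<subseteq> U" using * by blast
    moreover have "a \<in> (+) a ` frac_ideal v r"
      using zero_in_frac_ideal[of r] by (intro image_eqI[of _ _ 0]) simp_all
    ultimately show "a \<in> \<Union>?K" by blast
  qed
  then have "U = \<Union>?K" by blast
  moreover have "openin (field_top v) (\<Union>?K)"
    unfolding field_top_def by (intro openin_Union) (auto intro!: topology_generated_by_Basis)
  ultimately show "openin (field_top v) U" by simp
qed

lemma topspace_field_top [simp]: "topspace (field_top v) = UNIV"
  using openin_subset[of "field_top v" UNIV] by (auto simp: openin_field_top)

lemma openin_coset: "openin (field_top v) ((+) a ` frac_ideal v r)"
  unfolding field_top_def by (intro topology_generated_by_Basis) blast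

lemma openin_frac_ideal: "openin (field_top v) (frac_ideal v r)"
  using openin_coset[of 0 r] by (simp add: image_def)

lemma continuous_map_field_top:
  "continuous_map X (field_top v) f \<longleftrightarrow>
     (\<forall>y\<in>topspace X. \<forall>r. \<exists>U. openin X U \<and> y \<in> U \<and> (\<forall>z\<in>U. f z - f y \<in> frac_ideal v r))"
proof
  assume f: "continuous_map X (field_top v) f"
  show "\<forall>y\<in>topspace X. \<forall>r. \<exists>U. openin X U \<and> y \<in> U \<and> (\<forall>z\<in>U. f z - f y \<in> frac_ideal v r)"
  proof (intro ballI allI)
    fix y r assume "y \<in> topspace X"
    then show "\<exists>U. openin X U \<and> y \<in> U \<and> (\<forall>z\<in>U. f z - f y \<in> frac_ideal v r)"
      using openin_continuous_map_preimage[OF f openin_coset[of "f y" r]] zero_in_frac_ideal[of r]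
      by (intro exI[of _ "{z \<in> topspace X. f z \<in> (+) (f y) ` frac_ideal v r}"])
         (auto intro: image_eqI[of _ _ 0])
  qed
next
  assume *: "\<forall>y\<in>topspace X. \<forall>r. \<exists>U. openin X U \<and> y \<in> U \<and> (\<forall>z\<in>U. f z - f y \<in> frac_ideal v r)"
  show "continuous_map X (field_top v) f"
    unfolding continuous_map
  proof (intro conjI allI impI)
    fix W assume W: "openin (field_top v) W"
    show "openin X {z \<in> topspace X. f z \<in> W}"
    proof (subst openin_subopen, intro ballI)
      fix y assume y: "y \<in> {z \<in> topspace X. f z \<in> W}"
      then obtain r where r: "(+) (f y) ` frac_ideal v r \<subseteq> W"
        using W by (auto simp: openin_field_top)
      obtain U where U: "openin X U" "y \<in> U" "\<forall>z\<in>U. f z - f y \<in> frac_ideal v r"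
        using * y by blast
      have "f z \<in> W" if "z \<in> U" for z
        using r U(3) that by (metis add_diff_cancel_left' image_eqI subset_eq add.commute diff_add_cancel)
      then show "\<exists>T. openin X T \<and> y \<in> T \<and> T \<subseteq> {z \<in> topspace X. f z \<in> W}"
        using U openin_subset[OF U(1)] by blast
    qed
  qed simp
qed

lemma continuous_map_field_nbhd:
  assumes "continuous_map X (field_top v) f" "y \<in> topspace X"
  obtains U where "openin X U" "y \<in> U" "\<forall>z\<in>U. f z - f y \<in> frac_ideal v r"
  using assms that unfolding continuous_map_field_top by blast

lemma continuous_map_field_add:
  assumes "continuous_map X (field_top v) f" "continuous_map X (field_top v) g"
  shows "continuous_map X (field_top v) (\<lambda>z. f z + g z)"
  unfolding continuous_map_field_top
proof (intro ballI allI)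
  fix y r assume "y \<in> topspace X"
  then obtain U W where UW: "openin X U" "y \<in> U" "openin X W" "y \<in> W"
    and U: "\<forall>z\<in>U. f z - f y \<in> frac_ideal v r" and W: "\<forall>z\<in>W. g z - g y \<in> frac_ideal v r"
    using continuous_map_field_nbhd[OF assms(1), of y r] continuous_map_field_nbhd[OF assms(2), of y r]
    by metis
  have "f z + g z - (f y + g y) \<in> frac_ideal v r" if "z \<in> U \<inter> W" for z
    using frac_ideal_add[of "f z - f y" r "g z - g y"] U W that by (simp add: algebra_simps)
  then show "\<exists>U. openin X U \<and> y \<in> U \<and> (\<forall>z\<in>U. f z + g z - (f y + g y) \<in> frac_ideal v r)"
    using UW by (intro exI[of _ "U \<inter> W"]) auto
qed

lemma continuous_map_field_mult:
  assumes "continuous_map X (field_top v) f" "continuous_map X (field_top v) g"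
  shows "continuous_map X (field_top v) (\<lambda>z. f z * g z)"
  unfolding continuous_map_field_top
proof (intro ballI allI)
  fix y r assume "y \<in> topspace X"
  \<comment> \<open>Chosen for \<open>ab - a'b' = (a - a')(b - b') + a'(b - b') + b'(a - a')\<close>; \<open>0\<close> serves the quadratic term.\<close>
  define s where "s = max (max r 0) (max (r - v (f y)) (r - v (g y)))"
  obtain U W where UW: "openin X U" "y \<in> U" "openin X W" "y \<in> W"
    and U: "\<forall>z\<in>U. f z - f y \<in> frac_ideal v s" and W: "\<forall>z\<in>W. g z - g y \<in> frac_ideal v s"
    using continuous_map_field_nbhd[OF assms(1) \<open>y \<in> topspace X\<close>, of s]
      continuous_map_field_nbhd[OF assms(2) \<open>y \<in> topspace X\<close>, of s]
    by metis
  have "f z * g z - f y * g y \<in> frac_ideal v r" if "z \<in> U \<inter> W" for z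
  proof -
    have d: "f z - f y \<in> frac_ideal v s" "g z - g y \<in> frac_ideal v s"
      using U W that by blast+
    have *: "frac_ideal v (s + s) \<subseteq> frac_ideal v r" "frac_ideal v (v (f y) + s) \<subseteq> frac_ideal v r"
      "frac_ideal v (v (g y) + s) \<subseteq> frac_ideal v r"
      by (intro frac_ideal_antimono; simp add: s_def max_def)+
    have "(f z - f y) * (g z - g y) \<in> frac_ideal v r" "f y * (g z - g y) \<in> frac_ideal v r"
      "g y * (f z - f y) \<in> frac_ideal v r"
      using frac_ideal_mult[OF d] frac_ideal_mult[OF self_in_frac_ideal d(2)]
        frac_ideal_mult[OF self_in_frac_ideal d(1)] * by blast+
    then have "(f z - f y) * (g z - g y) + f y * (g z - g y) + g y * (f z - f y) \<in> frac_ideal v r"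
      by (intro frac_ideal_add)
    then show ?thesis by (simp add: algebra_simps)
  qed
  then show "\<exists>U. openin X U \<and> y \<in> U \<and> (\<forall>z\<in>U. f z * g z - f y * g y \<in> frac_ideal v r)"
    using UW by (intro exI[of _ "U \<inter> W"]) auto
qed

text \<open>Close to a nonzero value the valuation is locally constant, so the denominators in
\<open>1/a - 1/b = (b - a)/(a b)\<close> are under control.\<close>

lemma continuous_map_field_inverse:
  assumes "continuous_map X (field_top v) f" "\<And>z. z \<in> topspace X \<Longrightarrow> f z \<noteq> 0"
  shows "continuous_map X (field_top v) (\<lambda>z. inverse (f z))"
  unfolding continuous_map_field_top
proof (intro ballI allI)
  fix y r assume y: "y \<in> topspace X"
  \<comment> \<open>The first bound forces \<open>v (f z) \<le> v (f y)\<close>, the second one pays for both denominators.\<close>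
  define s where "s = max (v (f y) + 1) (r + 2 * v (f y))"
  obtain U where U: "openin X U" "y \<in> U" "\<forall>z\<in>U. f z - f y \<in> frac_ideal v s"
    using continuous_map_field_nbhd[OF assms(1) y] by blast
  have "inverse (f z) - inverse (f y) \<in> frac_ideal v r" if z: "z \<in> U" for z
  proof (cases "f z = f y")
    case True
    then show ?thesis by (simp add: zero_in_frac_ideal)
  next
    case False
    have nz: "f z \<noteq> 0" "f y \<noteq> 0"
      using assms(2) y z openin_subset[OF U(1)] by auto
    have d: "s \<le> v (f z - f y)"
      using U(3) z False by (auto simp: frac_ideal_def)
    have "v (f z) \<le> v (f y)"
    proof (rule ccontr)
      assume "\<not> v (f z) \<le> v (f y)"
      moreover have "min (v (f z)) (v (- (f z - f y))) \<le> v (f y)"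
        using v_add[of "f z" "- (f z - f y)"] nz False by simp
      moreover have "v (- (f z - f y)) = v (f z - f y)" by (rule v_minus)
      ultimately show False
        using d by (auto simp: s_def simp del: minus_diff_eq)
    qed
    moreover have "inverse (f z) - inverse (f y) = - (inverse (f z) * (f z - f y) * inverse (f y))"
      using nz by (rule inverse_diff_inverse)
    then have "v (inverse (f z) - inverse (f y)) = v (f z - f y) - v (f z) - v (f y)"
      using nz False by (simp add: v_mult v_inverse v_minus del: minus_diff_eq)
    ultimately show ?thesis
      using d by (auto simp: frac_ideal_def s_def)
  qed
  then show "\<exists>U. openin X U \<and> y \<in> U \<and> (\<forall>z\<in>U. inverse (f z) - inverse (f y) \<in> frac_ideal v r)"
    using U by blast
qed

lemma continuous_map_field_sum:
  assumes "\<And>i. i \<in> I \<Longrightarrow> continuous_map X (field_top v) (f i)"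
  shows "continuous_map X (field_top v) (\<lambda>z. \<Sum>i\<in>I. f i z)"
  using assms by (induction I rule: infinite_finite_induct) (auto intro: continuous_map_field_add)

lemma continuous_map_field_prod:
  assumes "\<And>i. i \<in> I \<Longrightarrow> continuous_map X (field_top v) (f i)"
  shows "continuous_map X (field_top v) (\<lambda>z. \<Prod>i\<in>I. f i z)"
  using assms by (induction I rule: infinite_finite_induct) (auto intro: continuous_map_field_mult)

lemma continuous_map_algebra_gen:
  assumes "f \<in> algebra_gen S" "\<And>g. g \<in> S \<Longrightarrow> continuous_map X (field_top v) g"
  shows "continuous_map X (field_top v) f"
  using assms(1)
  by induction (auto intro: assms(2) continuous_map_field_add continuous_map_field_mult)

subsection \<open>Compactness of the fractional ideals\<close>

text \<open>Finiteness of the residue field, transported by multiplication with a power of a uniformizer.\<close>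

lemma frac_ideal_finite_cover:
  obtains C where "finite C" "C \<subseteq> frac_ideal v r" "frac_ideal v r \<subseteq> (\<Union>c\<in>C. (+) c ` frac_ideal v (r + 1))"
proof -
  obtain \<pi> where \<pi>: "\<pi> \<noteq> 0" "v \<pi> = 1" using uniformizer by blast
  define p where "p = \<pi> powi r"
  have p: "p \<noteq> 0" "v p = r" using \<pi> by (simp_all add: p_def v_powi)
  obtain D where D: "finite D" "D \<subseteq> frac_ideal v 0"
    "residue_field v = (\<lambda>a. (+) a ` frac_ideal v 1) ` D"
    using finite_subset_image[OF finite_residue_field[unfolded residue_field_def] subset_refl]
    unfolding residue_field_def by auto
  show thesis
  proof (rule that[of "(*) p ` D"])
    show "(*) p ` D \<subseteq> frac_ideal v r"
      using D(2) scale_frac_ideal[OF p(1), of 0] p(2) by auto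
    show "frac_ideal v r \<subseteq> (\<Union>c\<in>(*) p ` D. (+) c ` frac_ideal v (r + 1))"
    proof
      fix a assume "a \<in> frac_ideal v r"
      then obtain b where b: "a = p * b" "b \<in> frac_ideal v 0"
        using scale_frac_ideal[OF p(1), of 0] p(2) by auto
      have "b \<in> (+) b ` frac_ideal v 1"
        using zero_in_frac_ideal by (intro image_eqI[of _ _ 0]) simp_all
      moreover have "(+) b ` frac_ideal v 1 \<in> residue_field v"
        using b(2) by (simp add: residue_field_def)
      moreover from this obtain d where "d \<in> D" "(+) b ` frac_ideal v 1 = (+) d ` frac_ideal v 1"
        using D(3) by auto
      ultimately have d: "d \<in> D" "b \<in> (+) d ` frac_ideal v 1"
        by simp_all
      then obtain e where e: "b = d + e" "e \<in> frac_ideal v 1" by blast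
      have "p * e \<in> frac_ideal v (r + 1)"
        using scale_frac_ideal[OF p(1), of 1] e(2) p(2) by (metis add.commute image_eqI)
      then show "a \<in> (\<Union>c\<in>(*) p ` D. (+) c ` frac_ideal v (r + 1))"
        using d(1) e(1) b(1) by (auto simp: distrib_left)
    qed
  qed (use D(1) in simp)
qed

text \<open>The bisection argument: if no finite subfamily of an open cover sufficed, the finitely
many cosets of the next smaller ideal would yield nested cosets with the same defect; their centres
form a Cauchy sequence, and the member of the cover that contains the limit covers all late cosets.\<close>

lemma compactin_frac_ideal: "compactin (field_top v) (frac_ideal v r)"
  unfolding compactin_def
proof (intro conjI allI impI; (elim conjE)?)
  fix \<U> assume opn: "\<forall>U\<in>\<U>. openin (field_top v) U" and cover: "frac_ideal v r \<subseteq> \<Union>\<U>"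
  define small where "small S \<longleftrightarrow> (\<exists>\<F>. finite \<F> \<and> \<F> \<subseteq> \<U> \<and> S \<subseteq> \<Union>\<F>)" for S
  have small_UN: "small (\<Union>c\<in>C. S c)" if "finite C" "\<And>c. c \<in> C \<Longrightarrow> small (S c)" for C and S :: "'f \<Rightarrow> 'f set"
    using that
  proof induction
    case empty
    then show ?case unfolding small_def by blast
  next
    case (insert c C)
    then obtain F F' where "finite F" "F \<subseteq> \<U>" "S c \<subseteq> \<Union>F" "finite F'" "F' \<subseteq> \<U>" "(\<Union>c\<in>C. S c) \<subseteq> \<Union>F'"
      unfolding small_def by (metis insertCI)
    then show ?case
      unfolding small_def by (intro exI[of _ "F \<union> F'"]) auto
  qed
  have step: "\<exists>b. b - a \<in> frac_ideal v s \<and> \<not> small ((+) b ` frac_ideal v (s + 1))"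
    if "\<not> small ((+) a ` frac_ideal v s)" for a s
  proof (rule ccontr)
    assume no: "\<nexists>b. b - a \<in> frac_ideal v s \<and> \<not> small ((+) b ` frac_ideal v (s + 1))"
    obtain C where C: "finite C" "C \<subseteq> frac_ideal v s"
      "frac_ideal v s \<subseteq> (\<Union>c\<in>C. (+) c ` frac_ideal v (s + 1))"
      by (rule frac_ideal_finite_cover)
    have "small (\<Union>c\<in>C. (+) (a + c) ` frac_ideal v (s + 1))"
      using C(2) no by (intro small_UN C(1)) auto
    moreover have "(+) a ` frac_ideal v s \<subseteq> (\<Union>c\<in>C. (+) (a + c) ` frac_ideal v (s + 1))"
      using C(3) by (fastforce simp: add.assoc)
    ultimately have "small ((+) a ` frac_ideal v s)"
      unfolding small_def by (meson order_trans)
    with that show False ..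
  qed
  have "small (frac_ideal v r)"
  proof (rule ccontr)
    assume "\<not> small (frac_ideal v r)"
    then have "\<not> small ((+) 0 ` frac_ideal v (r + int 0))" by (simp add: image_def)
    then obtain s where s0: "s 0 = 0" and s: "\<And>n. \<not> small ((+) (s n) ` frac_ideal v (r + int n))"
      "\<And>n. s (Suc n) - s n \<in> frac_ideal v (r + int n)"
    proof -
      \<comment> \<open>The clause for \<open>n = 0\<close> fixes the starting point of the sequence.\<close>
      define P where "P n a \<longleftrightarrow> (n = 0 \<longrightarrow> a = 0) \<and> \<not> small ((+) a ` frac_ideal v (r + int n))" for n a
      have "\<exists>s. \<forall>n. P n (s n) \<and> s (Suc n) - s n \<in> frac_ideal v (r + int n)"
      proof (rule dependent_nat_choice)
        show "\<exists>a. P 0 a"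
          using \<open>\<not> small ((+) 0 ` frac_ideal v (r + int 0))\<close> by (auto simp: P_def)
        show "\<exists>b. P (Suc n) b \<and> b - a \<in> frac_ideal v (r + int n)" if "P n a" for a n
          using step[of a "r + int n"] that by (auto simp: P_def add.assoc add.commute[of 1])
      qed
      then obtain s where s: "\<And>n. P n (s n)" "\<And>n. s (Suc n) - s n \<in> frac_ideal v (r + int n)"
        by blast
      show thesis
        using s(1)[unfolded P_def] s(2) by (intro that[of s]) simp_all
    qed
    have tail: "s (n + m) - s n \<in> frac_ideal v (r + int n)" for n m
    proof (induction m)
      case (Suc m)
      have "s (Suc (n + m)) - s (n + m) \<in> frac_ideal v (r + int n)"
        using s(2)[of "n + m"] frac_ideal_antimono[of "r + int n" "r + int (n + m)"] by auto
      from frac_ideal_add[OF this Suc] show ?case by simp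
    qed (simp add: zero_in_frac_ideal)
    have "\<exists>k. \<forall>m\<ge>k. \<forall>n\<ge>k. s m - s n \<in> frac_ideal v q" for q
    proof (intro exI allI impI)
      fix m n assume m: "nat (q - r) \<le> m" and n: "nat (q - r) \<le> n"
      have "s j - s (nat (q - r)) \<in> frac_ideal v q" if "nat (q - r) \<le> j" for j
      proof -
        have "q \<le> r + int (nat (q - r))" by simp
        then show ?thesis
          using tail[of "nat (q - r)" "j - nat (q - r)"] that frac_ideal_antimono by fastforce
      qed
      from frac_ideal_diff[OF this[OF m] this[OF n]] show "s m - s n \<in> frac_ideal v q" by simp
    qed
    then obtain l where l: "\<And>q. \<exists>k. \<forall>n\<ge>k. s n - l \<in> frac_ideal v q"
      using complete[of s] by blast
    have near: "l - s n \<in> frac_ideal v (r + int n)" for n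
    proof -
      obtain k where "\<forall>j\<ge>k. s j - l \<in> frac_ideal v (r + int n)" using l by blast
      then have "s (n + k) - l \<in> frac_ideal v (r + int n)" by simp
      from frac_ideal_diff[OF tail[of n k] this] show ?thesis by simp
    qed
    have "l \<in> frac_ideal v r" using near[of 0] s0 by simp
    then obtain U where U: "U \<in> \<U>" "l \<in> U" using cover by blast
    then obtain q where q: "(+) l ` frac_ideal v q \<subseteq> U"
      using opn by (meson openin_field_top)
    define n where "n = nat (q - r)"
    then have qn: "q \<le> r + int n" by simp
    have "(+) (s n) ` frac_ideal v (r + int n) \<subseteq> (+) l ` frac_ideal v q"
    proof clarify
      fix a assume a: "a \<in> frac_ideal v (r + int n)"
      have "a - (l - s n) \<in> frac_ideal v q"
        using frac_ideal_diff[OF a near] frac_ideal_antimono[OF qn] by blast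
      then show "s n + a \<in> (+) l ` frac_ideal v q"
        by (rule image_eqI[rotated]) simp
    qed
    then have "small ((+) (s n) ` frac_ideal v (r + int n))"
      unfolding small_def using U(1) q by (intro exI[of _ "{U}"]) auto
    then show False using s(1) by blast
  qed
  then show "\<exists>\<F>. finite \<F> \<and> \<F> \<subseteq> \<U> \<and> frac_ideal v r \<subseteq> \<Union>\<F>"
    unfolding small_def .
qed simp

subsection \<open>The absolute value\<close>

lemma card_residue_field: "1 < card (residue_field v)"
proof -
  have "(+) 0 ` frac_ideal v 1 \<in> residue_field v" "(+) 1 ` frac_ideal v 1 \<in> residue_field v"
    unfolding residue_field_def using v_one by (intro imageI; simp add: frac_ideal_def)+
  moreover have "0 \<in> (+) 0 ` frac_ideal v 1"
    using zero_in_frac_ideal by (simp add: image_def)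
  moreover have "0 \<notin> (+) 1 ` frac_ideal v 1"
    using v_minus_one by (auto simp: frac_ideal_def add_eq_0_iff)
  ultimately show ?thesis
    using finite_residue_field by (metis One_nat_def card_le_Suc0_iff_eq not_less)
qed

lemma padic_abs_eq_iff:
  assumes "s \<noteq> 0" "t \<noteq> 0"
  shows "padic_abs v s = padic_abs v t \<longleftrightarrow> v s = v t"
proof -
  have q: "1 < real (card (residue_field v))" using card_residue_field by simp
  show ?thesis
    using assms power_int_strict_increasing[of "- v s" "- v t", OF _ q]
      power_int_strict_increasing[of "- v t" "- v s", OF _ q]
    by (cases "v s" "v t" rule: linorder_cases) (simp_all add: padic_abs_def)
qed

subsection \<open>The topology on matrices\<close>

lemma topspace_matrix_top [simp]: "topspace (matrix_top v :: ('f^'n^'n) topology) = UNIV"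
  by (simp add: matrix_top_def topspace_pullback_topology)

lemma continuous_map_entry:
  "continuous_map (matrix_top v :: ('f^'n^'n) topology) (field_top v) (\<lambda>A. A $ i $ j)"
proof -
  have "continuous_map (matrix_top v) (field_top v)
      ((\<lambda>f. f (i, j)) \<circ> (\<lambda>A :: 'f^'n^'n. \<lambda>(i, j). A $ i $ j))"
    unfolding matrix_top_def
    by (intro continuous_map_pullback continuous_map_product_projection) simp
  then show ?thesis by (simp add: comp_def)
qed

lemma continuous_map_matrix_top:
  fixes f :: "'a \<Rightarrow> 'f^'n^'n"
  assumes "\<And>i j. continuous_map X (field_top v) (\<lambda>z. f z $ i $ j)"
  shows "continuous_map X (matrix_top v) f"
  unfolding matrix_top_def
  by (intro continuous_map_pullback')
     (auto simp: continuous_map_componentwise_UNIV comp_def assms)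

lemma continuous_map_matrix_mult:
  fixes f g :: "'a \<Rightarrow> 'f^'n^'n"
  assumes "continuous_map X (matrix_top v) f" "continuous_map X (matrix_top v) g"
  shows "continuous_map X (matrix_top v) (\<lambda>z. f z ** g z)"
proof (rule continuous_map_matrix_top)
  fix i j
  have "continuous_map X (field_top v) (\<lambda>z. f z $ i $ k)" "continuous_map X (field_top v) (\<lambda>z. g z $ k $ j)" for k
    using continuous_map_compose[OF assms(1) continuous_map_entry[of i k]]
      continuous_map_compose[OF assms(2) continuous_map_entry[of k j]] by (simp_all add: comp_def)
  then show "continuous_map X (field_top v) (\<lambda>z. (f z ** g z) $ i $ j)"
    unfolding matrix_matrix_mult_def
    by (auto intro!: continuous_map_field_sum continuous_map_field_mult)
qed

lemma continuous_map_det: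
  fixes f :: "'a \<Rightarrow> 'f^'n^'n"
  assumes "\<And>i j. continuous_map X (field_top v) (\<lambda>z. f z $ i $ j)"
  shows "continuous_map X (field_top v) (\<lambda>z. det (f z))"
  unfolding det_def
  by (intro continuous_map_field_sum continuous_map_field_mult continuous_map_field_prod assms) simp

text \<open>Cramer's rule gives the entries of the inverse as quotients of determinants.\<close>

lemma continuous_map_matrix_inv:
  fixes f :: "'a \<Rightarrow> 'f^'n^'n"
  assumes f: "continuous_map X (matrix_top v) f" and inv: "\<And>z. z \<in> topspace X \<Longrightarrow> invertible (f z)"
  shows "continuous_map X (matrix_top v) (\<lambda>z. matrix_inv (f z))"
proof (rule continuous_map_matrix_top)
  fix i j
  have entry: "continuous_map X (field_top v) (\<lambda>z. f z $ k $ l)" for k l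
    using continuous_map_compose[OF f continuous_map_entry[of k l]] by (simp add: comp_def)
  \<comment> \<open>Column \<open>j\<close> of the inverse solves a linear system with right-hand side the \<open>j\<close>-th unit vector.\<close>
  let ?M = "\<lambda>z. \<chi> k l. if l = i then axis j 1 $ k else f z $ k $ l"
  have "continuous_map X (field_top v) (\<lambda>z. det (?M z) * inverse (det (f z)))"
  proof (intro continuous_map_field_mult continuous_map_field_inverse continuous_map_det entry)
    fix k l
    show "continuous_map X (field_top v) (\<lambda>z. ?M z $ k $ l)"
      by (cases "l = i") (simp_all add: entry)
  qed (use inv in \<open>simp add: invertible_det_nz\<close>)
  then show "continuous_map X (field_top v) (\<lambda>z. matrix_inv (f z) $ i $ j)"
  proof (rule continuous_map_eq)
    fix z assume "z \<in> topspace X"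
    then have z: "invertible (f z)" "det (f z) \<noteq> 0" using inv by (simp_all flip: invertible_det_nz)
    have "f z *v (matrix_inv (f z) *v axis j 1) = axis j 1"
      using z(1) by (simp add: matrix_vector_mul_assoc matrix_inv_right)
    then have "matrix_inv (f z) *v axis j 1 = (\<chi> k. det (\<chi> i l. if l = k then axis j 1 $ i else f z $ i $ l) / det (f z))"
      using cramer[OF z(2)] by blast
    then have "(matrix_inv (f z) *v axis j 1) $ i = det (?M z) / det (f z)"
      by simp
    then show "det (?M z) * inverse (det (f z)) = matrix_inv (f z) $ i $ j"
      by (simp add: matrix_vector_mult_def axis_def divide_inverse if_distrib cong: if_cong)
  qed
qed

lemma continuous_map_regular_GL:
  fixes g :: "'f^'n^'n \<Rightarrow> 'f"
  assumes "g \<in> regular_GL"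
  shows "continuous_map (subtopology (matrix_top v) (carrier GL)) (field_top v) g"
  using assms unfolding regular_GL_def
proof (rule continuous_map_algebra_gen)
  have entry: "continuous_map (subtopology (matrix_top v) (carrier GL)) (field_top v)
    (\<lambda>A :: 'f^'n^'n. A $ i $ j)" for i j
    by (intro continuous_map_from_subtopology continuous_map_entry)
  fix f :: "'f^'n^'n \<Rightarrow> 'f"
  assume "f \<in> {\<lambda>A. A $ i $ j | i j. True} \<union> {\<lambda>A. inverse (det A)}"
  then show "continuous_map (subtopology (matrix_top v) (carrier GL)) (field_top v) f"
    using entry by (auto intro!: continuous_map_field_inverse continuous_map_det simp: invertible_det_nz)
qed

lemma compactin_set_mult:
  fixes S T :: "('f^'n^'n) set"
  assumes "compactin (matrix_top v) S" "compactin (matrix_top v) T"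
  shows "compactin (matrix_top v) (S <#>\<^bsub>GL\<^esub> T)"
proof -
  have "continuous_map (prod_topology (matrix_top v) (matrix_top v)) (matrix_top v)
      (\<lambda>z :: ('f^'n^'n) \<times> ('f^'n^'n). fst z ** snd z)"
    by (intro continuous_map_matrix_mult continuous_map_fst continuous_map_snd)
  with assms have "compactin (matrix_top v) ((\<lambda>z. fst z ** snd z) ` (S \<times> T))"
    by (intro image_compactin) (simp_all add: compactin_Times)
  moreover have "(\<lambda>z. fst z ** snd z) ` (S \<times> T) = S <#>\<^bsub>GL\<^esub> T"
    by (auto simp: set_mult_def GL_def image_def)
  ultimately show ?thesis by simp
qed

end

section \<open>Root subgroups\<close>

lemma powi_sum: "t \<noteq> 0 \<Longrightarrow> (\<Prod>i\<in>I. t powi f i) = t powi (\<Sum>i\<in>I. f i)"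
  for t :: "'f::field"
  by (induction I rule: infinite_finite_induct) (simp_all add: power_int_add)

lemma pairing_sum_simple: "pairing \<beta> l = (\<Sum>i\<in>UNIV. l $ i * pairing \<beta> (simple i))"
  unfolding UNIV_node by (simp add: pairing_explicit axis_def algebra_simps)

lemma root_char_powi:
  fixes t :: "'f::field"
  assumes "t \<noteq> 0"
  shows "root_char \<beta> (\<chi> i. t powi (l $ i)) = t powi pairing \<beta> l"
proof -
  have "root_char \<beta> (\<chi> i. t powi (l $ i)) = (\<Prod>i\<in>UNIV. t powi (l $ i * pairing \<beta> (simple i)))"
    by (simp add: root_char_def power_int_mult)
  also have "\<dots> = t powi pairing \<beta> l"
    by (subst pairing_sum_simple[of \<beta> l]) (rule powi_sum[OF assms])
  finally show ?thesis .
qed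

context split_sc_E6
begin

lemma x_invertible: "\<beta> \<in> roots \<Longrightarrow> invertible (x \<beta> t)"
  using x_immersion[of \<beta>] by (auto simp: closed_immersion_def image_subset_iff)

lemma x_0: assumes "\<beta> \<in> roots" shows "x \<beta> 0 = mat 1"
proof -
  have "matrix_inv (x \<beta> 0) ** x \<beta> (0 + 0) = (matrix_inv (x \<beta> 0) ** x \<beta> 0) ** x \<beta> 0"
    by (simp only: x_add[OF assms] matrix_mul_assoc)
  then show ?thesis
    by (simp add: matrix_inv_left x_invertible[OF assms])
qed

lemma matrix_inv_x: "\<beta> \<in> roots \<Longrightarrow> matrix_inv (x \<beta> t) = x \<beta> (- t)"
  by (rule matrix_inv_unique) (simp add: x_0 flip: x_add)

text \<open>This is where it matters that \<open>x\<^sub>\<beta>\<close> is a closed immersion: the coordinate of the line extends to a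
regular function on \<open>GL\<^sub>n\<close>.\<close>

lemma x_coordinate:
  assumes "\<beta> \<in> roots"
  obtains g where "g \<in> regular_GL" "\<And>t. g (x \<beta> t) = t"
proof -
  have "(\<lambda>t. t) \<in> (regular_line :: ('f \<Rightarrow> 'f) set)"
    unfolding regular_line_def by (intro algebra_gen.gen) simp
  then have "restrict (\<lambda>t. t) UNIV \<in> (\<lambda>g. restrict (g \<circ> x \<beta>) UNIV) ` regular_GL"
    using x_immersion[OF assms] unfolding closed_immersion_def by blast
  then obtain g where g: "g \<in> regular_GL" "restrict (g \<circ> x \<beta>) UNIV = restrict (\<lambda>t. t) UNIV"
    by auto
  have "g (x \<beta> t) = t" for t
    using fun_cong[OF g(2), of t] by simp
  with g(1) show thesis by (rule that)
qed

lemma x_inj: "\<beta> \<in> roots \<Longrightarrow> x \<beta> s = x \<beta> t \<Longrightarrow> s = t"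
  by (metis x_coordinate)

lemma x_entry_regular:
  assumes "\<beta> \<in> roots"
  shows "(\<lambda>t. x \<beta> t $ i $ j) \<in> regular_line"
proof -
  have "(\<lambda>A. A $ i $ j) \<in> (regular_GL :: ('f^'n^'n \<Rightarrow> 'f) set)"
    unfolding regular_GL_def by (intro algebra_gen.gen) blast
  then have "restrict ((\<lambda>A. A $ i $ j) \<circ> x \<beta>) UNIV \<in> (\<lambda>u. restrict u UNIV) ` regular_line"
    using x_immersion[OF assms] unfolding closed_immersion_def by blast
  then obtain u where u: "u \<in> regular_line" "restrict ((\<lambda>A. A $ i $ j) \<circ> x \<beta>) UNIV = restrict u UNIV"
    by auto
  have "u = (\<lambda>t. x \<beta> t $ i $ j)"
  proof
    fix t
    show "u t = x \<beta> t $ i $ j" using fun_cong[OF u(2), of t] by simp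
  qed
  with u(1) show ?thesis by simp
qed

lemma h_invertible: "a \<in> torus \<Longrightarrow> invertible (h a)"
  using h_in_G subgroup.subset[OF G_subgroup] by fastforce

lemma cochar_torus: "t \<noteq> 0 \<Longrightarrow> (\<chi> i. t powi (l $ i)) \<in> torus"
  by (simp add: torus_def)

lemma cochar_invertible: "t \<noteq> 0 \<Longrightarrow> invertible (cochar h l t)"
  unfolding cochar_def by (intro h_invertible cochar_torus)

lemma cochar_x:
  assumes "t \<noteq> 0" "\<beta> \<in> roots"
  shows "cochar h l t ** x \<beta> s ** matrix_inv (cochar h l t) = x \<beta> (t powi pairing \<beta> l * s)"
  unfolding cochar_def using assms by (simp add: h_x cochar_torus root_char_powi)

text \<open>Chevalley's commutator relation as an exchange rule, with the additional information that the
constant does not vanish. If it vanished, \<open>x\<^sub>\<beta>\<close> would commute with \<open>x\<^sub>\<alpha>\<close>; it commutes with \<open>x\<^bsub>-\<alpha>\<^esub>\<close> because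
\<open>\<beta> - \<alpha>\<close> is not a root, hence with the coroot \<open>\<alpha>\<^sup>\<or>\<close>, which is a product of such elements. But
\<open>\<alpha>\<^sup>\<or>(2)\<close> multiplies the argument of \<open>x\<^sub>\<beta>\<close> by \<open>1/2\<close>.\<close>

lemma structure_constant:
  assumes "\<alpha> \<in> roots" "\<beta> \<in> roots" "\<alpha> + \<beta> \<in> roots"
  obtains c :: int where "c \<noteq> 0"
    "\<And>s t. x \<alpha> s ** x \<beta> t = x (\<alpha> + \<beta>) (of_int c * s * t) ** x \<beta> t ** x \<alpha> s"
proof -
  obtain c :: int where c0: "\<forall>s t. x \<alpha> s ** x \<beta> t ** matrix_inv (x \<alpha> s) ** matrix_inv (x \<beta> t)
      = x (\<alpha> + \<beta>) (of_int c * s * t)"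
    using commutator[OF assms] by blast
  have c: "x \<alpha> s ** x \<beta> t = x (\<alpha> + \<beta>) (of_int c * s * t) ** x \<beta> t ** x \<alpha> s" for s t
  proof -
    let ?K = "x \<alpha> s ** x \<beta> t ** matrix_inv (x \<alpha> s) ** matrix_inv (x \<beta> t)"
    have "?K ** x \<beta> t ** x \<alpha> s
        = x \<alpha> s ** x \<beta> t ** matrix_inv (x \<alpha> s) ** (matrix_inv (x \<beta> t) ** x \<beta> t) ** x \<alpha> s"
      by (simp only: matrix_mul_assoc)
    also have "\<dots> = x \<alpha> s ** x \<beta> t ** (matrix_inv (x \<alpha> s) ** x \<alpha> s)"
      by (simp only: matrix_inv_left[OF x_invertible[OF assms(2)]] matrix_mul_rid matrix_mul_assoc)
    also have "\<dots> = x \<alpha> s ** x \<beta> t"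
      using assms by (simp add: matrix_inv_left x_invertible)
    finally show ?thesis
      by (simp only: c0[rule_format])
  qed
  moreover have "c \<noteq> 0"
  proof
    assume "c = 0"
    define B where "B = x \<beta> 1"
    have comm: "x \<alpha> s ** B = B ** x \<alpha> s" "x (- \<alpha>) s ** B = B ** x (- \<alpha>) s" for s
      using c[of s 1] \<open>c = 0\<close> x_0[OF assms(3)]
        commute[OF root_uminus[OF assms(1)] assms(2), of s 1] root_sum_diff[OF assms]
      by (simp_all add: B_def)
    have w: "B ** weyl_elt x \<alpha> t = weyl_elt x \<alpha> t ** B" for t
    proof -
      have "B ** weyl_elt x \<alpha> t = (B ** x \<alpha> t) ** x (- \<alpha>) (- inverse t) ** x \<alpha> t"
        by (simp only: weyl_elt_def matrix_mul_assoc)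
      also have "\<dots> = x \<alpha> t ** (B ** x (- \<alpha>) (- inverse t)) ** x \<alpha> t"
        by (simp only: comm(1)[symmetric] matrix_mul_assoc)
      also have "\<dots> = x \<alpha> t ** x (- \<alpha>) (- inverse t) ** (B ** x \<alpha> t)"
        by (simp only: comm(2)[symmetric] matrix_mul_assoc)
      also have "\<dots> = weyl_elt x \<alpha> t ** B"
        by (simp only: weyl_elt_def comm(1)[symmetric] matrix_mul_assoc)
      finally show ?thesis .
    qed
    have "invertible (weyl_elt x \<alpha> 1)"
      using assms(1) by (simp add: weyl_elt_def invertible_mult x_invertible root_uminus)
    then have w1: "B ** matrix_inv (weyl_elt x \<alpha> 1) = matrix_inv (weyl_elt x \<alpha> 1) ** B"
      by (rule commute_matrix_inv) (rule w)
    let ?H = "cochar h (coroot \<alpha>) 2"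
    have H: "?H = weyl_elt x \<alpha> 2 ** matrix_inv (weyl_elt x \<alpha> 1)"
      using h_coroot[OF assms(1), of 2] by simp
    have "B ** ?H = ?H ** B"
      unfolding H by (metis w w1 matrix_mul_assoc)
    then have "?H ** B ** matrix_inv ?H = B"
      by (simp add: conjugate_eq_iff cochar_invertible)
    then have "x \<beta> (2 powi pairing \<beta> \<alpha> * 1) = x \<beta> 1"
      using cochar_x[OF _ assms(2), of 2 "coroot \<alpha>" 1] by (simp add: B_def coroot_def)
    then have "2 powi pairing \<beta> \<alpha> * 1 = (1 :: 'f)"
      by (rule x_inj[OF assms(2)])
    then show False
      using root_sum_diff(1)[OF assms] by (simp add: power_int_minus)
  qed
  ultimately show thesis by (rule that[rotated])
qed

end

section \<open>Ordered products in the Heisenberg group\<close>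

definition root_product ::
  "(int^node \<Rightarrow> 'f::field \<Rightarrow> 'f^'n^'n) \<Rightarrow> (int^node \<Rightarrow> 'f set) \<Rightarrow> (int^node) list \<Rightarrow> ('f^'n^'n) set" where
  "root_product x V L = ordered_product (map (\<lambda>\<eta>. x \<eta> ` V \<eta>) L)"

text \<open>The point with coordinates \<open>a\<close>. A single function on roots supplies the coordinates for every
enumeration, so that coordinates can be compared between a list and its sublists.\<close>

definition root_element ::
  "(int^node \<Rightarrow> 'f::field \<Rightarrow> 'f^'n^'n) \<Rightarrow> (int^node \<Rightarrow> 'f) \<Rightarrow> (int^node) list \<Rightarrow> 'f^'n^'n" where
  "root_element x a L = foldr (\<lambda>\<eta> n. x \<eta> (a \<eta>) ** n) L (mat 1)"

text \<open>Besides closure under addition and negation, the condition says that \<open>V\<close> at \<open>-\<gamma>\<^sub>0\<close> absorbs all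
possible commutators; the integer \<open>c\<close> stands for an arbitrary structure constant. Both the
constant family \<open>UNIV\<close> and the fractional ideals of the lattice groups are instances.\<close>

definition heisenberg_lattice :: "(int^node \<Rightarrow> 'f::field set) \<Rightarrow> bool" where
  "heisenberg_lattice V \<longleftrightarrow>
     (\<forall>\<eta>\<in>roots_N_neg. 0 \<in> V \<eta> \<and> (\<forall>a\<in>V \<eta>. \<forall>b\<in>V \<eta>. a + b \<in> V \<eta>) \<and> (\<forall>a\<in>V \<eta>. - a \<in> V \<eta>)) \<and>
     (\<forall>\<eta>\<in>roots_N_neg. \<forall>\<eta>'\<in>roots_N_neg. \<eta> + \<eta>' = - highest_root \<longrightarrow>
        (\<forall>a\<in>V \<eta>. \<forall>b\<in>V \<eta>'. \<forall>c::int. of_int c * a * b \<in> V (- highest_root)))"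

lemma root_product_Nil: "root_product x V [] = {mat 1}"
  by (simp add: root_product_def)

lemma mem_root_product_Cons:
  "n \<in> root_product x V (\<eta> # L) \<longleftrightarrow> (\<exists>a\<in>V \<eta>. \<exists>m\<in>root_product x V L. n = x \<eta> a ** m)"
  by (auto simp: root_product_def mem_set_mult_GL)

lemma mem_root_product:
  assumes "distinct L"
  shows "n \<in> root_product x V L \<longleftrightarrow> (\<exists>a. (\<forall>\<eta>\<in>set L. a \<eta> \<in> V \<eta>) \<and> n = root_element x a L)"
  using assms
proof (induction L arbitrary: n)
  case Nil
  then show ?case by (simp add: root_product_Nil root_element_def)
next
  case (Cons \<theta> L)
  show ?case
  proof
    assume "n \<in> root_product x V (\<theta> # L)"
    then obtain b a where b: "b \<in> V \<theta>" "\<forall>\<eta>\<in>set L. a \<eta> \<in> V \<eta>" "n = x \<theta> b ** root_element x a L"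
      using Cons by (auto simp: mem_root_product_Cons)
    have "root_element x a L = root_element x (a(\<theta> := b)) L"
      unfolding root_element_def using Cons.prems by (intro foldr_cong) auto
    then have "n = root_element x (a(\<theta> := b)) (\<theta> # L)"
      using b(3) by (simp add: root_element_def)
    then show "\<exists>a. (\<forall>\<eta>\<in>set (\<theta> # L). a \<eta> \<in> V \<eta>) \<and> n = root_element x a (\<theta> # L)"
      using b(1,2) by (intro exI[of _ "a(\<theta> := b)"]) auto
  next
    assume "\<exists>a. (\<forall>\<eta>\<in>set (\<theta> # L). a \<eta> \<in> V \<eta>) \<and> n = root_element x a (\<theta> # L)"
    then show "n \<in> root_product x V (\<theta> # L)"
      using Cons by (auto simp: mem_root_product_Cons root_element_def)
  qed
qed

lemma root_product_mono:
  assumes "\<And>\<eta>. \<eta> \<in> set L \<Longrightarrow> V \<eta> \<subseteq> W \<eta>"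
  shows "root_product x V L \<subseteq> root_product x W L"
  unfolding root_product_def
  by (rule ordered_product_mono) (use assms in \<open>simp add: list_all2_conv_all_nth image_mono\<close>)

context split_sc_E6
begin

lemma x_lowest_root_central:
  assumes "- highest_root \<in> roots_N_neg" "\<beta> \<in> roots_N_neg"
  shows "x \<beta> s ** x (- highest_root) t = x (- highest_root) t ** x \<beta> s"
  using assms roots_N_neg_sum[OF assms(2,1)] roots_N_neg_add_nonzero[OF assms(2,1)]
  by (intro commute) (auto simp: roots_N_neg_iff)

lemma x_swap:
  assumes V: "heisenberg_lattice V" and z: "- highest_root \<in> roots_N_neg"
    and \<alpha>: "\<alpha> \<in> roots_N_neg" and \<beta>: "\<beta> \<in> roots_N_neg" and a: "a \<in> V \<alpha>" and b: "b \<in> V \<beta>"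
  obtains d where "d \<in> V (- highest_root)" "x \<alpha> a ** x \<beta> b = x \<beta> b ** (x \<alpha> a ** x (- highest_root) d)"
proof (cases "\<alpha> + \<beta> \<in> roots")
  case True
  have roots: "\<alpha> \<in> roots" "\<beta> \<in> roots" using \<alpha> \<beta> by (auto simp: roots_N_neg_iff)
  note sum = roots_N_neg_sum(1)[OF \<alpha> \<beta> True]
  obtain c :: int where c: "x \<alpha> a ** x \<beta> b = x (- highest_root) (of_int c * a * b) ** x \<beta> b ** x \<alpha> a"
    using structure_constant[OF roots True] sum by metis
  show thesis
  proof (rule that)
    show "of_int c * a * b \<in> V (- highest_root)"
      using V \<alpha> \<beta> a b sum unfolding heisenberg_lattice_def by blast
    show "x \<alpha> a ** x \<beta> b = x \<beta> b ** (x \<alpha> a ** x (- highest_root) (of_int c * a * b))"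
      unfolding c by (metis matrix_mul_assoc x_lowest_root_central[OF z \<alpha>] x_lowest_root_central[OF z \<beta>])
  qed
next
  case False
  then have "x \<alpha> a ** x \<beta> b = x \<beta> b ** x \<alpha> a"
    using \<alpha> \<beta> roots_N_neg_add_nonzero[OF \<alpha> \<beta>] by (intro commute) (auto simp: roots_N_neg_iff)
  moreover have "0 \<in> V (- highest_root)" using V z by (auto simp: heisenberg_lattice_def)
  ultimately show thesis
    using z by (intro that[of 0]) (simp_all add: x_0 roots_N_neg_iff)
qed

text \<open>Induction on the list: \<open>x\<^sub>\<beta>\<close> either merges with the first factor or passes it, leaving a factor at
\<open>-\<gamma>\<^sub>0\<close>, and both of these belong into the remaining product. Placing \<open>-\<gamma>\<^sub>0\<close> last makes it a member of
every tail, which is what the induction hypothesis requires.\<close>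

lemma root_product_left_mult:
  assumes V: "heisenberg_lattice V" and z: "- highest_root \<in> roots_N_neg"
  shows "set L \<subseteq> roots_N_neg \<Longrightarrow> \<beta> \<in> insert (- highest_root) (set L) \<Longrightarrow> b \<in> V \<beta> \<Longrightarrow>
    n \<in> root_product x V (L @ [- highest_root]) \<Longrightarrow> x \<beta> b ** n \<in> root_product x V (L @ [- highest_root])"
proof (induction L arbitrary: \<beta> b n)
  case Nil
  then obtain c where "c \<in> V \<beta>" "n = x \<beta> c" "\<beta> = - highest_root"
    by (auto simp: mem_root_product_Cons root_product_Nil)
  moreover have "\<beta> \<in> roots" "b + c \<in> V \<beta>"
    using V z Nil calculation by (auto simp: roots_N_neg_iff heisenberg_lattice_def)
  ultimately show ?case
    using Nil by (auto simp: mem_root_product_Cons root_product_Nil simp flip: x_add)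
next
  case (Cons \<gamma> L)
  let ?P = "root_product x V (L @ [- highest_root])"
  obtain c m where c: "c \<in> V \<gamma>" "m \<in> ?P" "n = x \<gamma> c ** m"
    using Cons.prems(4) by (auto simp: mem_root_product_Cons)
  have \<gamma>: "\<gamma> \<in> roots_N_neg" and \<beta>: "\<beta> \<in> roots_N_neg" using Cons.prems z by auto
  show ?case
  proof (cases "\<beta> = \<gamma>")
    case True
    have "b + c \<in> V \<gamma>"
      using V \<gamma> c(1) Cons.prems(3) True by (auto simp: heisenberg_lattice_def)
    moreover have "x \<beta> b ** n = x \<gamma> (b + c) ** m"
      using \<gamma> True c(3) by (simp add: x_add roots_N_neg_iff matrix_mul_assoc)
    ultimately show ?thesis
      using c(2) by (auto simp: mem_root_product_Cons)
  next
    case False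
    obtain d where d: "d \<in> V (- highest_root)"
      "x \<beta> b ** x \<gamma> c = x \<gamma> c ** (x \<beta> b ** x (- highest_root) d)"
      using x_swap[OF V z \<beta> \<gamma> Cons.prems(3) c(1)] .
    have "x (- highest_root) d ** m \<in> ?P"
      using Cons.prems(1) by (intro Cons.IH d(1) c(2)) auto
    then have "x \<beta> b ** (x (- highest_root) d ** m) \<in> ?P"
      using Cons.prems(1-3) False by (intro Cons.IH[of \<beta>]) simp_all
    moreover have "x \<beta> b ** n = x \<gamma> c ** (x \<beta> b ** (x (- highest_root) d ** m))"
      using d(2) c(3) by (simp add: matrix_mul_assoc)
    ultimately show ?thesis
      using c(1) by (auto simp: mem_root_product_Cons)
  qed
qed

lemma one_in_root_product:
  assumes "heisenberg_lattice V" "set L \<subseteq> roots_N_neg"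
  shows "mat 1 \<in> root_product x V L"
  using assms(2)
proof (induction L)
  case (Cons \<eta> L)
  moreover have "0 \<in> V \<eta>" "x \<eta> 0 = mat 1"
    using assms(1) Cons.prems by (auto simp: heisenberg_lattice_def x_0 roots_N_neg_iff)
  ultimately show ?case by (force simp: mem_root_product_Cons)
qed (simp add: root_product_Nil)

lemma root_generators_in_GL: "(\<Union>\<beta>\<in>roots_N_neg. x \<beta> ` V \<beta>) \<subseteq> carrier GL"
  by (auto simp: x_invertible roots_N_neg_iff)

text \<open>The ordered product contains the identity and is stable under left multiplication by generators,
hence by all of the generated group.\<close>

lemma root_product_eq_generate:
  assumes V: "heisenberg_lattice V" and L: "set \<eta>s = roots_N_neg" "last \<eta>s = - highest_root"
  shows "root_product x V \<eta>s = generate GL (\<Union>\<beta>\<in>roots_N_neg. x \<beta> ` V \<beta>)"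
proof -
  have ne: "\<eta>s \<noteq> []" using L(1) minus_simple_in_roots_N_neg by auto
  then have z: "- highest_root \<in> roots_N_neg" using L last_in_set by metis
  have split: "\<eta>s = butlast \<eta>s @ [- highest_root]" using ne L(2) by (metis append_butlast_last_id)
  then have sub: "set (butlast \<eta>s) \<subseteq> roots_N_neg" "insert (- highest_root) (set (butlast \<eta>s)) = roots_N_neg"
    using L(1) by (metis in_set_butlastD subsetI, metis Un_insert_right list.set(2) set_append sup_bot_right list.set(1))
  have closed: "x \<beta> b ** n \<in> root_product x V \<eta>s"
    if "\<beta> \<in> roots_N_neg" "b \<in> V \<beta>" "n \<in> root_product x V \<eta>s" for \<beta> b n
    using root_product_left_mult[OF V z sub(1), of \<beta> b n] that sub(2) split by metis
  have "g ** n \<in> root_product x V \<eta>s"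
    if "g \<in> generate GL (\<Union>\<beta>\<in>roots_N_neg. x \<beta> ` V \<beta>)" "n \<in> root_product x V \<eta>s" for g n
    using that
  proof (induction arbitrary: n)
    case (incl g)
    then show ?case using closed by auto
  next
    case (inv g)
    then obtain \<beta> b where b: "\<beta> \<in> roots_N_neg" "b \<in> V \<beta>" "g = x \<beta> b" by auto
    then have "inv\<^bsub>GL\<^esub> g = x \<beta> (- b)" "- b \<in> V \<beta>"
      using V by (auto simp: inv_GL x_invertible matrix_inv_x roots_N_neg_iff heisenberg_lattice_def)
    then show ?case using closed[OF b(1) _ inv(2)] by simp
  next
    case (eng g g')
    then show ?case by (simp flip: matrix_mul_assoc)
  qed simp
  from this[OF _ one_in_root_product[OF V]] have "generate GL (\<Union>\<beta>\<in>roots_N_neg. x \<beta> ` V \<beta>) \<subseteq> root_product x V \<eta>s"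
    using L(1) by auto
  moreover have "root_product x V \<eta>s \<subseteq> generate GL (\<Union>\<beta>\<in>roots_N_neg. x \<beta> ` V \<beta>)"
    unfolding root_product_def
    by (intro ordered_product_in_subgroup GL.generate_is_subgroup root_generators_in_GL)
       (use L(1) in \<open>auto intro: generate.incl\<close>)
  ultimately show ?thesis by blast
qed

lemma Nbar_eq_root_product:
  assumes "set \<eta>s = roots_N_neg" "last \<eta>s = - highest_root"
  shows "Nbar x = root_product x (\<lambda>_. UNIV) \<eta>s"
  using assms by (subst root_product_eq_generate)
    (auto simp: heisenberg_lattice_def Nbar_def root_subgroups_generate_def)

end

section \<open>Coordinates on the Heisenberg group\<close>

context split_sc_E6
begin

lemma root_element_Cons: "root_element x a (\<eta> # L) = x \<eta> (a \<eta>) ** root_element x a L"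
  by (simp add: root_element_def)

lemma root_element_append:
  "root_element x a (L @ L') = root_element x a L ** root_element x a L'"
  by (induction L) (simp_all add: root_element_def matrix_mul_assoc)

lemma root_element_invertible: "set L \<subseteq> roots \<Longrightarrow> invertible (root_element x a L)"
proof (induction L)
  case Nil
  have "invertible (mat 1 :: 'f^'n^'n)" using GL.one_closed by simp
  then show ?case by (simp add: root_element_def)
qed (simp add: root_element_Cons invertible_mult x_invertible)

text \<open>Write \<open>\<gamma> = -\<gamma>\<^sub>0 - \<eta>\<close>. Among the roots of \<open>Nbar x\<close> only \<open>\<eta>\<close> adds up with \<open>\<gamma>\<close> to a root, so moving \<open>x\<^sub>\<gamma>(1)\<close>
through an ordered product picks up one central factor, which displays the coordinate at \<open>\<eta>\<close>.\<close>

lemma complementary_commutator: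
  assumes z: "- highest_root \<in> roots_N_neg" and \<eta>: "\<eta> \<in> roots_N_neg" "\<eta> \<noteq> - highest_root"
  obtains c :: int where "c \<noteq> 0"
    "\<And>a L. set L \<subseteq> roots_N_neg \<Longrightarrow> distinct L \<Longrightarrow>
      x (- highest_root - \<eta>) 1 ** root_element x a L =
      x (- highest_root) (if \<eta> \<in> set L then of_int c * a \<eta> else 0) ** root_element x a L ** x (- highest_root - \<eta>) 1"
proof -
  define \<gamma> where "\<gamma> = - highest_root - \<eta>"
  define Z where "Z = x (- highest_root)"
  have \<gamma>: "\<gamma> \<in> roots_N_neg" unfolding \<gamma>_def by (rule highest_root_complement[OF \<eta> z])
  have sum: "\<gamma> + \<eta> = - highest_root" by (simp add: \<gamma>_def)
  have roots: "\<gamma> \<in> roots" "\<eta> \<in> roots" "- highest_root \<in> roots"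
    using \<gamma> \<eta> z by (auto simp: roots_N_neg_iff)
  obtain c :: int where c: "c \<noteq> 0" "\<And>s t. x \<gamma> s ** x \<eta> t = Z (of_int c * s * t) ** x \<eta> t ** x \<gamma> s"
    using structure_constant[OF roots(1,2)] roots(3) unfolding sum Z_def by metis
  have central: "x \<beta> s ** Z t = Z t ** x \<beta> s" if "\<beta> \<in> roots_N_neg" for \<beta> s t
    unfolding Z_def using x_lowest_root_central[OF z that] .
  have "x \<gamma> 1 ** root_element x a L = Z (if \<eta> \<in> set L then of_int c * a \<eta> else 0) ** root_element x a L ** x \<gamma> 1"
    if "set L \<subseteq> roots_N_neg" "distinct L" for a L
    using that
  proof (induction L)
    case Nil
    then show ?case by (simp add: root_element_def Z_def x_0 roots)
  next
    case (Cons \<theta> L)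
    let ?R = "root_element x a L"
    define d where "d = (if \<eta> \<in> set L then of_int c * a \<eta> else 0)"
    have IH: "x \<gamma> 1 ** ?R = Z d ** ?R ** x \<gamma> 1"
      using Cons by (simp add: d_def)
    have \<theta>: "\<theta> \<in> roots_N_neg" using Cons.prems by simp
    have "x \<gamma> 1 ** x \<theta> (a \<theta>) = Z (if \<theta> = \<eta> then of_int c * a \<theta> else 0) ** x \<theta> (a \<theta>) ** x \<gamma> 1"
    proof (cases "\<theta> = \<eta>")
      case True
      then show ?thesis using c(2)[of 1 "a \<eta>"] by simp
    next
      case False
      then have "\<gamma> + \<theta> \<notin> roots"
        using roots_N_neg_sum(1)[OF \<gamma> \<theta>] by (auto simp: \<gamma>_def)
      then have "x \<gamma> 1 ** x \<theta> (a \<theta>) = x \<theta> (a \<theta>) ** x \<gamma> 1"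
        using \<gamma> \<theta> roots_N_neg_add_nonzero[OF \<gamma> \<theta>] by (intro commute) (auto simp: roots_N_neg_iff)
      then show ?thesis using False by (simp add: Z_def x_0 roots)
    qed
    moreover define e where "e = (if \<theta> = \<eta> then of_int c * a \<theta> else 0)"
    ultimately have step: "x \<gamma> 1 ** x \<theta> (a \<theta>) = Z e ** x \<theta> (a \<theta>) ** x \<gamma> 1" by simp
    have "x \<gamma> 1 ** root_element x a (\<theta> # L) = (x \<gamma> 1 ** x \<theta> (a \<theta>)) ** ?R"
      by (simp only: root_element_Cons matrix_mul_assoc)
    also have "\<dots> = Z e ** x \<theta> (a \<theta>) ** (x \<gamma> 1 ** ?R)"
      by (simp only: step matrix_mul_assoc)
    also have "\<dots> = Z e ** (x \<theta> (a \<theta>) ** Z d) ** ?R ** x \<gamma> 1"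
      by (simp only: IH matrix_mul_assoc)
    also have "\<dots> = (Z e ** Z d) ** root_element x a (\<theta> # L) ** x \<gamma> 1"
      by (simp only: central[OF \<theta>] root_element_Cons matrix_mul_assoc)
    also have "Z e ** Z d = Z (e + d)"
      unfolding Z_def by (simp add: x_add roots)
    also have "e + d = (if \<eta> \<in> set (\<theta> # L) then of_int c * a \<eta> else 0)"
      using Cons.prems by (auto simp: e_def d_def)
    finally show ?case .
  qed
  with c(1) show thesis
    unfolding \<gamma>_def Z_def by (rule that)
qed

end

locale p_adic_E6 = p_adic_field v + split_sc_E6 G h x
  for v :: "'f::field_char_0 \<Rightarrow> int"
    and G :: "('f^'n^'n) set"
    and h :: "'f^node \<Rightarrow> 'f^'n^'n"
    and x :: "int^node \<Rightarrow> 'f \<Rightarrow> 'f^'n^'n"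
begin

lemma continuous_map_x:
  assumes "\<beta> \<in> roots"
  shows "continuous_map (field_top v) (matrix_top v) (x \<beta>)"
proof (rule continuous_map_matrix_top)
  show "continuous_map (field_top v) (field_top v) (\<lambda>t. x \<beta> t $ i $ j)" for i j
    using x_entry_regular[OF assms] unfolding regular_line_def
    by (rule continuous_map_algebra_gen) simp
qed

lemma continuous_map_x_compose:
  assumes "\<beta> \<in> roots" "continuous_map X (field_top v) f"
  shows "continuous_map X (matrix_top v) (\<lambda>n. x \<beta> (f n))"
  using continuous_map_compose[OF assms(2) continuous_map_x[OF assms(1)]] by (simp add: comp_def)

lemma continuous_map_root_element:
  assumes "set L \<subseteq> roots" "\<And>\<eta>. \<eta> \<in> set L \<Longrightarrow> continuous_map X (field_top v) (\<lambda>n. a n \<eta>)"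
  shows "continuous_map X (matrix_top v) (\<lambda>n. root_element x (a n) L)"
  using assms
proof (induction L)
  case Nil
  then show ?case by (simp add: root_element_def)
next
  case (Cons \<eta> L)
  then show ?case
    by (simp add: root_element_Cons continuous_map_matrix_mult continuous_map_x_compose)
qed

lemma continuous_map_regular_compose:
  assumes "g \<in> regular_GL" "continuous_map X (matrix_top v) f" "\<And>n. n \<in> topspace X \<Longrightarrow> invertible (f n)"
  shows "continuous_map X (field_top v) (\<lambda>n. g (f n))"
proof -
  have "continuous_map X (subtopology (matrix_top v) (carrier GL)) f"
    using assms(2,3) by (auto simp: continuous_map_in_subtopology)
  from continuous_map_compose[OF this continuous_map_regular_GL[OF assms(1)]]
  show ?thesis by (simp add: comp_def)
qed

lemma Nbar_subset_GL: "Nbar x \<subseteq> carrier GL"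
  unfolding Nbar_def root_subgroups_generate_def
  using GL.generate_incl[OF root_generators_in_GL[of "\<lambda>_. UNIV"]] .

text \<open>The commutator of \<open>n\<close> with \<open>x\<^sub>\<gamma>(1)\<close> is a continuous function of \<open>n\<close>, lies in the root subgroup of \<open>-\<gamma>\<^sub>0\<close>,
and has argument \<open>c\<close> times the coordinate at \<open>\<eta>\<close>. Dividing by \<open>c\<close> is possible in characteristic \<open>0\<close>.\<close>

lemma root_coordinate:
  assumes ord: "is_ordering \<eta>s roots_N_neg" "last \<eta>s = - highest_root"
    and \<eta>: "\<eta> \<in> roots_N_neg" "\<eta> \<noteq> - highest_root"
  obtains A where "continuous_map (subtopology (matrix_top v) (Nbar x)) (field_top v) A"
    "\<And>a. A (root_element x a \<eta>s) = a \<eta>"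
proof -
  let ?X = "subtopology (matrix_top v) (Nbar x)"
  let ?z = "- highest_root" and ?\<gamma> = "- highest_root - \<eta>"
  have L: "set \<eta>s = roots_N_neg" "distinct \<eta>s" using ord by (auto simp: is_ordering_def)
  then have z: "?z \<in> roots_N_neg"
    using ord(2) \<eta>(1) by (metis last_in_set empty_iff list.set(1))
  have \<gamma>: "?\<gamma> \<in> roots_N_neg"
    by (rule highest_root_complement[OF \<eta> z])
  have roots: "?z \<in> roots" "?\<gamma> \<in> roots" using z \<gamma> by (auto simp: roots_N_neg_iff)
  obtain c :: int where c: "c \<noteq> 0"
    "\<And>a L. set L \<subseteq> roots_N_neg \<Longrightarrow> distinct L \<Longrightarrow>
      x ?\<gamma> 1 ** root_element x a L =
      x ?z (if \<eta> \<in> set L then of_int c * a \<eta> else 0) ** root_element x a L ** x ?\<gamma> 1"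
    by (rule complementary_commutator[OF z \<eta>]) (rule that; blast)
  have swap: "x ?\<gamma> 1 ** root_element x a \<eta>s = x ?z (of_int c * a \<eta>) ** root_element x a \<eta>s ** x ?\<gamma> 1" for a
    using c(2)[of \<eta>s a] L \<eta>(1) by simp
  obtain g where g: "g \<in> regular_GL" "\<And>t. g (x ?z t) = t"
    using x_coordinate[OF roots(1)] by blast
  define A where "A n = inverse (of_int c) * g (x ?\<gamma> 1 ** n ** x ?\<gamma> (- 1) ** matrix_inv n)" for n
  have id: "continuous_map ?X (matrix_top v) (\<lambda>n. n)"
    by (rule continuous_map_from_subtopology) simp
  have inv: "invertible n" if "n \<in> Nbar x" for n
    using that Nbar_subset_GL by auto
  have "continuous_map ?X (field_top v) A"
    unfolding A_def
    by (intro continuous_map_field_mult continuous_map_regular_compose[OF g(1)] continuous_map_matrix_mult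
        continuous_map_matrix_inv id)
      (auto simp: invertible_mult x_invertible roots inv invertible_matrix_inv)
  moreover have "A (root_element x a \<eta>s) = a \<eta>" for a
  proof -
    let ?n = "root_element x a \<eta>s"
    have n: "invertible ?n" by (rule root_element_invertible) (auto simp: L roots_N_neg_iff)
    have "x ?\<gamma> 1 ** ?n ** x ?\<gamma> (- 1) ** matrix_inv ?n
        = x ?z (of_int c * a \<eta>) ** ?n ** (x ?\<gamma> 1 ** x ?\<gamma> (- 1)) ** matrix_inv ?n"
      by (simp only: swap matrix_mul_assoc)
    also have "x ?\<gamma> 1 ** x ?\<gamma> (- 1) = mat 1"
      by (simp add: roots x_0 flip: x_add)
    also have "x ?z (of_int c * a \<eta>) ** ?n ** mat 1 ** matrix_inv ?n = x ?z (of_int c * a \<eta>)"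
      using n by (simp add: matrix_inv_right flip: matrix_mul_assoc)
    finally show ?thesis
      using c(1) by (simp add: A_def g(2))
  qed
  ultimately show thesis by (rule that)
qed

text \<open>The central coordinate is invisible to commutators. The other coordinates, being continuous already,
determine all factors but the last one; these are divided out.\<close>

lemma lowest_root_coordinate:
  assumes ord: "is_ordering \<eta>s roots_N_neg" "last \<eta>s = - highest_root"
  obtains A where "continuous_map (subtopology (matrix_top v) (Nbar x)) (field_top v) A"
    "\<And>a. A (root_element x a \<eta>s) = a (- highest_root)"
proof -
  let ?X = "subtopology (matrix_top v) (Nbar x)"
  define z where "z = - highest_root"
  have L: "set \<eta>s = roots_N_neg" "distinct \<eta>s" using ord by (auto simp: is_ordering_def)
  have ne: "\<eta>s \<noteq> []" using L(1) minus_simple_in_roots_N_neg by auto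
  define L' where "L' = butlast \<eta>s"
  have split: "\<eta>s = L' @ [z]" using ne ord(2) by (metis L'_def append_butlast_last_id z_def)
  have L': "set L' \<subseteq> roots_N_neg" "z \<notin> set L'" "set L' \<subseteq> roots" and z: "z \<in> roots"
    using L unfolding split by (auto simp: roots_N_neg_iff)
  have "\<exists>A. continuous_map ?X (field_top v) A \<and> (\<forall>a. A (root_element x a \<eta>s) = a \<eta>)"
    if "\<eta> \<in> set L'" for \<eta>
  proof -
    have "\<eta> \<in> roots_N_neg" "\<eta> \<noteq> - highest_root" using that L' by (auto simp: z_def)
    then show ?thesis by (rule root_coordinate[OF ord]) blast
  qed
  then obtain A where A: "\<And>\<eta>. \<eta> \<in> set L' \<Longrightarrow> continuous_map ?X (field_top v) (A \<eta>)"
    "\<And>\<eta> a. \<eta> \<in> set L' \<Longrightarrow> A \<eta> (root_element x a \<eta>s) = a \<eta>"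
    by metis
  obtain g where g: "g \<in> regular_GL" "\<And>t. g (x z t) = t"
    using x_coordinate[OF z] by blast
  define B where "B n = g (matrix_inv (root_element x (\<lambda>\<eta>. A \<eta> n) L') ** n)" for n
  have id: "continuous_map ?X (matrix_top v) (\<lambda>n. n)"
    by (rule continuous_map_from_subtopology) simp
  have inv: "invertible n" if "n \<in> Nbar x" for n
    using that Nbar_subset_GL by auto
  have "continuous_map ?X (field_top v) B"
    unfolding B_def
    by (intro continuous_map_regular_compose[OF g(1)] continuous_map_matrix_mult
        continuous_map_matrix_inv continuous_map_root_element id L' A(1))
      (auto simp: invertible_mult inv invertible_matrix_inv root_element_invertible L')
  moreover have "B (root_element x a \<eta>s) = a (- highest_root)" for a
  proof -
    let ?n = "root_element x a \<eta>s" and ?m = "root_element x a L'"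
    have "root_element x (\<lambda>\<eta>. A \<eta> ?n) L' = ?m"
      unfolding root_element_def by (intro foldr_cong) (simp_all add: A(2)[unfolded root_element_def])
    moreover have "?n = ?m ** x z (a z)"
      unfolding split by (simp add: root_element_append) (simp add: root_element_def)
    moreover have "invertible ?m" by (rule root_element_invertible[OF L'(3)])
    ultimately have "matrix_inv (root_element x (\<lambda>\<eta>. A \<eta> ?n) L') ** ?n = x z (a z)"
      by (simp add: matrix_mul_assoc matrix_inv_left)
    then show ?thesis by (simp add: B_def g(2) flip: z_def)
  qed
  ultimately show thesis by (rule that)
qed

lemma Nbar_coordinates:
  assumes ord: "is_ordering \<eta>s roots_N_neg" "last \<eta>s = - highest_root"
  shows "\<exists>A. \<forall>\<eta>\<in>roots_N_neg. continuous_map (subtopology (matrix_top v) (Nbar x)) (field_top v) (A \<eta>) \<and>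
    (\<forall>a. A \<eta> (root_element x a \<eta>s) = a \<eta>)"
proof (rule bchoice, rule ballI)
  fix \<eta> assume \<eta>: "\<eta> \<in> roots_N_neg"
  show "\<exists>A. continuous_map (subtopology (matrix_top v) (Nbar x)) (field_top v) A \<and>
      (\<forall>a. A (root_element x a \<eta>s) = a \<eta>)"
  proof (cases "\<eta> = - highest_root")
    case True
    then show ?thesis by (auto intro: lowest_root_coordinate[OF ord])
  next
    case False
    show ?thesis by (rule root_coordinate[OF ord \<eta> False]) blast
  qed
qed

section \<open>The lattice subgroups\<close>

lemma Nbar0_eq_root_product: "Nbar0 v x \<eta>s k = root_product x (\<lambda>\<eta>. frac_ideal v (rbar k \<eta>)) \<eta>s"
  by (simp add: Nbar0_def root_product_def root_lattice_subgroup_def)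

text \<open>Adding the bounds at two roots of level \<open>-1\<close> with sum \<open>-\<gamma>\<^sub>0\<close> gives exactly the bound at \<open>-\<gamma>\<^sub>0\<close>; this is
the reason for the factor \<open>2\<close> in front of \<open>\<kappa>\<close>.\<close>

lemma heisenberg_lattice_rbar: "heisenberg_lattice (\<lambda>\<eta>. frac_ideal v (rbar k \<eta>))"
  unfolding heisenberg_lattice_def
proof (intro conjI ballI impI allI)
  fix \<eta> \<eta>' a b and c :: int
  assume \<eta>: "\<eta> \<in> roots_N_neg" "\<eta>' \<in> roots_N_neg" "\<eta> + \<eta>' = - highest_root"
    and a: "a \<in> frac_ideal v (rbar k \<eta>)" and b: "b \<in> frac_ideal v (rbar k \<eta>')"
  have level: "\<eta> $ N2 + \<eta>' $ N2 = - 2"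
    using arg_cong[OF \<eta>(3), of "\<lambda>\<beta>. \<beta> $ N2"] by (simp add: highest_root_def)
  then have ne: "\<eta> \<noteq> - highest_root" "\<eta>' \<noteq> - highest_root"
    using roots_N_neg_level[OF \<eta>(1)] roots_N_neg_level[OF \<eta>(2)] by (auto split: if_splits)
  have "rbar k \<eta> + rbar k \<eta>' = - 2 * k - pairing (\<eta> + \<eta>') two_rho_check"
    using ne by (simp add: rbar_def pairing_linear)
  then have "rbar k \<eta> + rbar k \<eta>' = rbar k (- highest_root)"
    by (simp add: \<eta>(3) rbar_def)
  then show "of_int c * a * b \<in> frac_ideal v (rbar k (- highest_root))"
    using frac_ideal_mult[OF frac_ideal_mult[OF of_int_in_frac_ideal a] b, of c] by simp
qed (auto intro: zero_in_frac_ideal frac_ideal_add frac_ideal_uminus)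

lemma Nbar0_eq_generate:
  assumes "is_ordering \<eta>s roots_N_neg" "last \<eta>s = - highest_root"
  shows "Nbar0 v x \<eta>s k = generate GL (\<Union>\<beta>\<in>roots_N_neg. x \<beta> ` frac_ideal v (rbar k \<beta>))"
  unfolding Nbar0_eq_root_product
  using assms by (intro root_product_eq_generate heisenberg_lattice_rbar) (auto simp: is_ordering_def)

lemma subgroup_Nbar0:
  assumes "is_ordering \<eta>s roots_N_neg" "last \<eta>s = - highest_root"
  shows "subgroup (Nbar0 v x \<eta>s k) (GL\<lparr>carrier := Nbar x\<rparr>)"
  unfolding Nbar0_eq_generate[OF assms] Nbar_def root_subgroups_generate_def
  using root_generators_in_GL[of "\<lambda>_. UNIV"] root_generators_in_GL[of "\<lambda>\<beta>. frac_ideal v (rbar k \<beta>)"]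
  by (intro GL.subgroup_incl GL.generate_is_subgroup GL.mono_generate) auto

lemma Nbar0_subset_Nbar:
  assumes "is_ordering \<eta>s roots_N_neg" "last \<eta>s = - highest_root"
  shows "Nbar0 v x \<eta>s k \<subseteq> Nbar x"
  using subgroup.subset[OF subgroup_Nbar0[OF assms]] by simp

lemma mem_Nbar:
  assumes "is_ordering \<eta>s roots_N_neg" "last \<eta>s = - highest_root"
  shows "n \<in> Nbar x \<longleftrightarrow> (\<exists>a. n = root_element x a \<eta>s)"
  using assms Nbar_eq_root_product[of \<eta>s] mem_root_product[of \<eta>s n x "\<lambda>_. UNIV"]
  by (simp add: is_ordering_def)

lemma mem_Nbar0:
  assumes "is_ordering \<eta>s roots_N_neg"
  shows "n \<in> Nbar0 v x \<eta>s k \<longleftrightarrow>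
    (\<exists>a. (\<forall>\<eta>\<in>roots_N_neg. a \<eta> \<in> frac_ideal v (rbar k \<eta>)) \<and> n = root_element x a \<eta>s)"
  using assms mem_root_product[of \<eta>s n x "\<lambda>\<eta>. frac_ideal v (rbar k \<eta>)"]
  by (simp add: is_ordering_def Nbar0_eq_root_product)

text \<open>Membership is the condition that finitely many continuous coordinates lie in open ideals.\<close>

lemma openin_Nbar0:
  assumes ord: "is_ordering \<eta>s roots_N_neg" "last \<eta>s = - highest_root"
  shows "openin (subtopology (matrix_top v) (Nbar x)) (Nbar0 v x \<eta>s k)"
proof -
  let ?X = "subtopology (matrix_top v) (Nbar x)"
  obtain A where A: "\<And>\<eta>. \<eta> \<in> roots_N_neg \<Longrightarrow> continuous_map ?X (field_top v) (A \<eta>)"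
    "\<And>\<eta> a. \<eta> \<in> roots_N_neg \<Longrightarrow> A \<eta> (root_element x a \<eta>s) = a \<eta>"
    using Nbar_coordinates[OF ord] by blast
  let ?U = "\<lambda>\<eta>. {n \<in> topspace ?X. A \<eta> n \<in> frac_ideal v (rbar k \<eta>)}"
  have "finite roots_N_neg" using ord(1) unfolding is_ordering_def by (metis List.finite_set)
  then have "openin ?X ((\<Inter>\<eta>\<in>roots_N_neg. ?U \<eta>) \<inter> topspace ?X)"
    by (intro openin_INT openin_continuous_map_preimage[OF A(1) openin_frac_ideal])
  also have "(\<Inter>\<eta>\<in>roots_N_neg. ?U \<eta>) \<inter> topspace ?X = Nbar0 v x \<eta>s k"
  proof (intro equalityI subsetI)
    fix n assume n: "n \<in> (\<Inter>\<eta>\<in>roots_N_neg. ?U \<eta>) \<inter> topspace ?X"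
    then obtain a where a: "n = root_element x a \<eta>s" by (auto simp: mem_Nbar[OF ord])
    with n show "n \<in> Nbar0 v x \<eta>s k" by (auto simp: mem_Nbar0[OF ord(1)] A(2))
  next
    fix n assume n: "n \<in> Nbar0 v x \<eta>s k"
    then have "n \<in> topspace ?X" using Nbar0_subset_Nbar[OF ord] by auto
    with n show "n \<in> (\<Inter>\<eta>\<in>roots_N_neg. ?U \<eta>) \<inter> topspace ?X"
      by (auto simp: mem_Nbar0[OF ord(1)] A(2))
  qed
  finally show ?thesis .
qed

lemma compactin_Nbar0:
  assumes ord: "is_ordering \<eta>s roots_N_neg" "last \<eta>s = - highest_root"
  shows "compactin (subtopology (matrix_top v) (Nbar x)) (Nbar0 v x \<eta>s k)"
proof -
  have "compactin (matrix_top v) (ordered_product (map (\<lambda>\<eta>. x \<eta> ` frac_ideal v (r \<eta>)) L))"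
    if "set L \<subseteq> roots" for L r
    using that
  proof (induction L)
    case Nil
    then show ?case by simp
  next
    case (Cons \<eta> L)
    then show ?case
      by (simp add: compactin_set_mult image_compactin[OF compactin_frac_ideal continuous_map_x])
  qed
  from this[of \<eta>s "rbar k"] show ?thesis
    using ord Nbar0_subset_Nbar[OF ord, of k]
    by (simp add: compactin_subtopology Nbar0_def root_lattice_subgroup_def is_ordering_def roots_N_neg_iff subset_iff)
qed

lemma rbar_antimono: "k1 \<le> k2 \<Longrightarrow> rbar k2 \<eta> \<le> rbar k1 \<eta>"
  by (simp add: rbar_def)

lemma Nbar0_mono: "k1 \<le> k2 \<Longrightarrow> Nbar0 v x \<eta>s k1 \<subseteq> Nbar0 v x \<eta>s k2"
  unfolding Nbar0_eq_root_product
  by (intro root_product_mono frac_ideal_antimono rbar_antimono)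

lemma Union_Nbar0:
  assumes ord: "is_ordering \<eta>s roots_N_neg" "last \<eta>s = - highest_root"
  shows "(\<Union>k\<in>{0..}. Nbar0 v x \<eta>s k) = Nbar x"
proof
  show "Nbar x \<subseteq> (\<Union>k\<in>{0..}. Nbar0 v x \<eta>s k)"
  proof
    fix n assume "n \<in> Nbar x"
    then obtain a where a: "n = root_element x a \<eta>s" by (auto simp: mem_Nbar[OF ord])
    \<comment> \<open>The sum dominates each of its finitely many terms, hence is large enough at all roots at once.\<close>
    define K where "K = (\<Sum>\<eta>\<in>roots_N_neg. \<bar>v (a \<eta>)\<bar> + \<bar>pairing \<eta> two_rho_check\<bar>)"
    have fin: "finite roots_N_neg" using ord(1) unfolding is_ordering_def by (metis List.finite_set)
    have "0 \<le> K" unfolding K_def by (intro sum_nonneg) simp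
    moreover have "a \<eta> \<in> frac_ideal v (rbar K \<eta>)" if "\<eta> \<in> roots_N_neg" for \<eta>
    proof -
      have "\<bar>v (a \<eta>)\<bar> + \<bar>pairing \<eta> two_rho_check\<bar> \<le> K"
        unfolding K_def by (rule member_le_sum[OF that]) (use fin in auto)
      then have "rbar K \<eta> \<le> v (a \<eta>)" by (auto simp: rbar_def)
      then show ?thesis by (simp add: frac_ideal_def)
    qed
    ultimately show "n \<in> (\<Union>k\<in>{0..}. Nbar0 v x \<eta>s k)"
      using a by (auto simp: mem_Nbar0[OF ord(1)])
  qed
qed (use Nbar0_subset_Nbar[OF ord] in blast)

text \<open>A root \<open>\<alpha>\<close> of \<open>M\<close> has level \<open>0\<close>, so \<open>\<alpha> + \<eta>\<close> has the level of \<open>\<eta>\<close>; as \<open>-\<gamma>\<^sub>0\<close> is the only root of its level, it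
does not occur when \<open>\<alpha> + \<eta>\<close> is a root, and the bound at \<open>\<alpha> + \<eta>\<close> is the sum of the bounds at \<open>\<alpha>\<close> and \<open>\<eta>\<close>.\<close>

lemma conjugate_Nbar0_subset:
  assumes ord: "is_ordering \<eta>s roots_N_neg" "last \<eta>s = - highest_root"
    and \<alpha>: "\<alpha> \<in> roots_M_pos" and s: "s \<in> frac_ideal v (- pairing \<alpha> two_rho_check)"
  shows "conjugate_set (x \<alpha> s) (Nbar0 v x \<eta>s k) \<subseteq> Nbar0 v x \<eta>s k"
  unfolding Nbar0_eq_generate[OF ord]
proof (rule conjugate_set_generate_subset)
  have \<alpha>_root: "\<alpha> \<in> roots" and \<alpha>_level: "\<alpha> $ N2 = 0"
    using \<alpha> by (auto simp: roots_M_pos_def roots_M_def)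
  show "invertible (x \<alpha> s)" by (rule x_invertible[OF \<alpha>_root])
  let ?S = "\<Union>\<beta>\<in>roots_N_neg. x \<beta> ` frac_ideal v (rbar k \<beta>)"
  fix A assume "A \<in> ?S"
  then obtain \<eta> t where \<eta>: "\<eta> \<in> roots_N_neg" and t: "t \<in> frac_ideal v (rbar k \<eta>)" and A: "A = x \<eta> t"
    by auto
  have \<eta>_root: "\<eta> \<in> roots" and \<eta>_level: "\<eta> $ N2 < 0" using \<eta> by (auto simp: roots_N_neg_iff)
  show "x \<alpha> s ** A ** matrix_inv (x \<alpha> s) \<in> generate GL ?S"
  proof (cases "\<alpha> + \<eta> \<in> roots")
    case True
    have sum: "\<alpha> + \<eta> \<in> roots_N_neg"
      using True \<alpha>_level \<eta>_level by (simp add: roots_N_neg_iff)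
    have "\<alpha> \<noteq> 0" using \<alpha>_root zero_not_root by blast
    then have "\<eta> \<noteq> - highest_root" "\<alpha> + \<eta> \<noteq> - highest_root"
      using roots_N_neg_level[OF sum] roots_N_neg_level[OF \<eta>] \<alpha>_level by (auto split: if_splits)
    then have r: "rbar k (\<alpha> + \<eta>) = - pairing \<alpha> two_rho_check + rbar k \<eta>"
      by (simp add: rbar_def pairing_linear)
    obtain c :: int where "x \<alpha> s ** x \<eta> t = x (\<alpha> + \<eta>) (of_int c * s * t) ** x \<eta> t ** x \<alpha> s"
      using structure_constant[OF \<alpha>_root \<eta>_root True] by metis
    then have "x \<alpha> s ** A ** matrix_inv (x \<alpha> s) = x (\<alpha> + \<eta>) (of_int c * s * t) ** x \<eta> t"
      unfolding A conjugate_eq_iff[OF x_invertible[OF \<alpha>_root]] .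
    moreover have "of_int c * s * t \<in> frac_ideal v (rbar k (\<alpha> + \<eta>))"
      using frac_ideal_mult[OF frac_ideal_mult[OF of_int_in_frac_ideal s] t, of c] by (simp add: r)
    ultimately show ?thesis
      using sum \<eta> t generate.eng[of "x (\<alpha> + \<eta>) (of_int c * s * t)" GL ?S "x \<eta> t"]
      by (auto intro: generate.incl)
  next
    case False
    have "(\<alpha> + \<eta>) $ N2 \<noteq> 0" using \<alpha>_level \<eta>_level by simp
    then have "\<alpha> + \<eta> \<noteq> 0" by (metis zero_index)
    then have "x \<alpha> s ** A ** matrix_inv (x \<alpha> s) = A"
      unfolding A conjugate_eq_iff[OF x_invertible[OF \<alpha>_root]]
      by (rule commute[OF \<alpha>_root \<eta>_root False])
    then show ?thesis using \<open>A \<in> ?S\<close> by (simp add: generate.incl)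
  qed
qed (rule root_generators_in_GL)+

lemma U0_normalizes_Nbar0:
  assumes ord: "is_ordering \<eta>s roots_N_neg" "last \<eta>s = - highest_root"
    and \<alpha>s: "is_ordering \<alpha>s roots_M_pos" and u: "u \<in> U0 v x \<alpha>s"
  shows "conjugate_set u (Nbar0 v x \<eta>s k) = Nbar0 v x \<eta>s k"
proof -
  let ?N = "Nbar0 v x \<eta>s k"
  have gen: "conjugate_set (x \<alpha> s) ?N = ?N"
    if "\<alpha> \<in> roots_M_pos" "s \<in> frac_ideal v (- pairing \<alpha> two_rho_check)" for \<alpha> s
  proof -
    have \<alpha>: "\<alpha> \<in> roots" using that by (auto simp: roots_M_pos_def roots_M_def)
    show ?thesis
    proof (rule conjugate_set_eqI)
      show "conjugate_set (matrix_inv (x \<alpha> s)) ?N \<subseteq> ?N"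
        using conjugate_Nbar0_subset[OF ord that(1) frac_ideal_uminus[OF that(2)]] by (simp add: matrix_inv_x \<alpha>)
    qed (use conjugate_Nbar0_subset[OF ord that] x_invertible[OF \<alpha>] in auto)
  qed
  have "invertible u \<and> conjugate_set u ?N = ?N"
    if "set L \<subseteq> roots_M_pos"
      "u \<in> ordered_product (map (\<lambda>\<alpha>. root_lattice_subgroup v x \<alpha> (- pairing \<alpha> two_rho_check)) L)" for L u
    using that
  proof (induction L arbitrary: u)
    case Nil
    moreover have "matrix_inv (mat 1) = (mat 1 :: 'f^'n^'n)" by (rule matrix_inv_unique) simp
    moreover have "invertible (mat 1 :: 'f^'n^'n)" using GL.one_closed by simp
    ultimately show ?case by (simp add: conjugate_set_def)
  next
    case (Cons \<alpha> L)
    then obtain s w where s: "s \<in> frac_ideal v (- pairing \<alpha> two_rho_check)" "u = x \<alpha> s ** w"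
      and w: "w \<in> ordered_product (map (\<lambda>\<alpha>. root_lattice_subgroup v x \<alpha> (- pairing \<alpha> two_rho_check)) L)"
      by (auto simp: mem_set_mult_GL root_lattice_subgroup_def)
    have "invertible (x \<alpha> s)" using Cons.prems(1) by (auto simp: x_invertible roots_M_pos_def roots_M_def)
    moreover have "invertible w" "conjugate_set w ?N = ?N" using Cons w by auto
    moreover have "conjugate_set (x \<alpha> s) ?N = ?N" using Cons.prems(1) gen s(1) by simp
    ultimately show ?case
      by (simp add: s(2) invertible_mult conjugate_set_mult)
  qed
  then show ?thesis
    using u \<alpha>s unfolding U0_def is_ordering_def by blast
qed

subsection \<open>The action of the coroot of the highest root\<close>

text \<open>The pairing of a root with \<open>\<gamma>\<^sub>0\<^sup>\<or>\<close> is its level, which vanishes on the roots of \<open>M\<close>.\<close>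

lemma cochar_center:
  assumes "t \<noteq> 0"
  shows "cochar h (coroot highest_root) t \<in> center_M h x"
proof -
  let ?c = "cochar h (coroot highest_root) t" and ?S = "h ` torus \<union> (\<Union>\<beta>\<in>roots_M. range (x \<beta>))"
  have "?c \<in> Levi_M h x"
    unfolding Levi_M_def using cochar_torus[OF assms] by (auto simp: cochar_def intro!: generate.incl)
  moreover have S: "invertible g \<and> ?c ** g = g ** ?c" if g: "g \<in> ?S" for g
  proof -
    consider a where "a \<in> torus" "g = h a" | \<beta> s where "\<beta> \<in> roots_M" "g = x \<beta> s"
      using g by auto
    then show ?thesis
    proof cases
      case 1
      then show ?thesis
        using cochar_torus[OF assms, of "coroot highest_root"]
        by (simp add: h_invertible cochar_def mult.commute flip: h_mult)
    next
      case 2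
      then have \<beta>: "\<beta> \<in> roots" "pairing \<beta> (coroot highest_root) = 0"
        by (auto simp: roots_M_def coroot_def pairing_highest_root)
      then show ?thesis
        using cochar_x[OF assms \<beta>(1), of "coroot highest_root" s] 2(2)
        by (simp add: conjugate_eq_iff cochar_invertible assms x_invertible)
    qed
  qed
  moreover have "?c ** m = m ** ?c" if "m \<in> Levi_M h x" for m
    using that unfolding Levi_M_def
  proof induction
    case (inv g)
    then show ?case using S by (simp add: inv_GL commute_matrix_inv)
  next
    case (eng g g')
    then show ?case by simp (metis matrix_mul_assoc)
  qed (use S in auto)
  ultimately show ?thesis by (simp add: center_M_def)
qed

text \<open>Conjugation scales the factor at \<open>\<eta>\<close> by \<open>t\<close> to the power of the level of \<open>\<eta>\<close>, and \<open>\<kappa>\<close> enters the bound at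
\<open>\<eta>\<close> multiplied by the same level.\<close>

lemma conjugate_cochar_Nbar0:
  assumes ord: "is_ordering \<eta>s roots_N_neg" and t: "t \<noteq> 0"
  shows "conjugate_set (cochar h (coroot highest_root) t) (Nbar0 v x \<eta>s k) = Nbar0 v x \<eta>s (k + v t)"
proof -
  let ?c = "cochar h (coroot highest_root) t"
  have "conjugate_set ?c (x \<eta> ` frac_ideal v (rbar k \<eta>)) = x \<eta> ` frac_ideal v (rbar (k + v t) \<eta>)"
    if \<eta>: "\<eta> \<in> roots_N_neg" for \<eta>
  proof -
    have root: "\<eta> \<in> roots" using \<eta> by (simp add: roots_N_neg_iff)
    have "conjugate_set ?c (x \<eta> ` frac_ideal v (rbar k \<eta>))
        = x \<eta> ` (*) (t powi (\<eta> $ N2)) ` frac_ideal v (rbar k \<eta>)"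
      by (simp add: conjugate_set_def image_image cochar_x[OF t root] coroot_def pairing_highest_root)
    also have "(*) (t powi (\<eta> $ N2)) ` frac_ideal v (rbar k \<eta>) = frac_ideal v (rbar k \<eta> + \<eta> $ N2 * v t)"
      using t by (simp add: scale_frac_ideal v_powi)
    also have "rbar k \<eta> + \<eta> $ N2 * v t = rbar (k + v t) \<eta>"
      using roots_N_neg_level[OF \<eta>] by (simp add: rbar_def)
    finally show ?thesis .
  qed
  then have "map (conjugate_set ?c \<circ> (\<lambda>\<eta>. x \<eta> ` frac_ideal v (rbar k \<eta>))) \<eta>s
      = map (\<lambda>\<eta>. x \<eta> ` frac_ideal v (rbar (k + v t) \<eta>)) \<eta>s"
    using ord by (intro map_cong) (auto simp: is_ordering_def)
  then show ?thesis
    unfolding Nbar0_def root_lattice_subgroup_def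
    by (simp only: conjugate_set_ordered_product[OF cochar_invertible[OF t]] map_map)
qed

end

theorem lemma3p17:
  fixes v :: "'f::field_char_0 \<Rightarrow> int"
    and G :: "('f^'n^'n) set"
    and h :: "'f^node \<Rightarrow> 'f^'n^'n"
    and x :: "int^node \<Rightarrow> 'f \<Rightarrow> 'f^'n^'n"
    and \<eta>s \<alpha>s :: "(int^node) list"
  assumes "p_adic_field v"
    and "split_sc_E6 G h x"
    and "is_ordering \<eta>s roots_N_neg" and "last \<eta>s = - highest_root"
    and "is_ordering \<alpha>s roots_M_pos"
  shows
    "(\<forall>k. subgroup (Nbar0 v x \<eta>s k) (GL\<lparr>carrier := Nbar x\<rparr>) \<and>
          openin (subtopology (matrix_top v) (Nbar x)) (Nbar0 v x \<eta>s k) \<and>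
          compactin (subtopology (matrix_top v) (Nbar x)) (Nbar0 v x \<eta>s k)) \<and>
     (\<forall>k1 k2. k1 \<le> k2 \<longrightarrow> Nbar0 v x \<eta>s k1 \<subseteq> Nbar0 v x \<eta>s k2) \<and>
     (\<Union>k\<in>{0..}. Nbar0 v x \<eta>s k) = Nbar x \<and>
     (\<forall>k. \<forall>u\<in>U0 v x \<alpha>s. conjugate_set u (Nbar0 v x \<eta>s k) = Nbar0 v x \<eta>s k) \<and>
     (\<forall>t. t \<noteq> 0 \<longrightarrow> cochar h (coroot highest_root) t \<in> center_M h x) \<and>
     (\<forall>k t. t \<noteq> 0 \<longrightarrow>
        conjugate_set (cochar h (coroot highest_root) t) (Nbar0 v x \<eta>s k)
          = Nbar0 v x \<eta>s (k + v t)) \<and>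
     (\<forall>k s t. s \<noteq> 0 \<longrightarrow> t \<noteq> 0 \<longrightarrow> v s = v t \<longrightarrow>
        conjugate_set (cochar h (coroot highest_root) s) (Nbar0 v x \<eta>s k)
          = conjugate_set (cochar h (coroot highest_root) t) (Nbar0 v x \<eta>s k)) \<and>
     (\<forall>s t. s \<noteq> 0 \<longrightarrow> t \<noteq> 0 \<longrightarrow> (v s = v t \<longleftrightarrow> padic_abs v s = padic_abs v t))"
proof -
  interpret p_adic_E6 v G h x
    using assms(1,2) by (intro p_adic_E6.intro)
  note ord = assms(3,4)
  show ?thesis
    by (intro conjI allI impI ballI)
       (simp_all add: subgroup_Nbar0[OF ord] openin_Nbar0[OF ord] compactin_Nbar0[OF ord] Nbar0_mono
         Union_Nbar0[OF ord] U0_normalizes_Nbar0[OF ord assms(5)] cochar_center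
         conjugate_cochar_Nbar0[OF ord(1)] padic_abs_eq_iff)
qed

end
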